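(* Let $n,k,m$ be positive integers and let $v\in\mathbb{R}^{[n]^k}$ be a vector determined by (maintaining some statistic of) a data stream of $m$ items, each from $[n]^k$. Let $h_1,\dots,h_k:[n]\to\{-1,1\}$ be random functions such that for each $i$ the values $h_i(1),\dots,h_i(n)$ are 4-wise independent and uniform on $\{-1,1\}$, and $h_1,\dots,h_k$ are mutually independent; let $H(\mathbf p)=\prod_{i=1}^k h_i(p_i)$ for $\mathbf p\in[n]^k$, and $Y=\left(\sum_{\mathbf p\in[n]^k}v_{\mathbf p}H(\mathbf p)\right)^2$. Let $\epsilon,\delta\in(0,1)$. If there is a streaming algorithm that maintains an instance of $Y$ using $O(\mu(n,m,k,\epsilon,\delta))$ memory bits, then there exists a streaming algorithm $\Lambda$ such that (1) with probability at least $1-\delta$, $\Lambda$ outputs a value in $[(1-\epsilon)\|v\|^2,(1+\epsilon)\|v\|^2]$, and (2) the space complexity of $\Lambda$ is $O\!\left(3^k\frac{1}{\epsilon^2}\log\frac1\delta\,\mu(n,m,k,\epsilon,\delta)\right)$.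
   Context: $\|v\|^2=\sum_{\mathbf p\in[n]^k}v_{\mathbf p}^2$. A family of functions $[n]\to\{-1,1\}$ is 4-wise independent if for any distinct $i_1,\dots,i_4\in[n]$ and any $b_1,\dots,b_4\in\{-1,1\}$, $\Pr[h(i_1)=b_1,\dots,h(i_4)=b_4]=1/16$. A streaming algorithm reads the stream items one at a time in a single pass.
   Formalization: The O-bounds have a constant uniform in n, m, k, ε and in δ ≤ δ₀ for each δ₀ < 1 (uniformity up to δ → 1 fails since log(1/δ) → 0), and 4-wise independence is required on all sets of at most four points, which matters only for n < 4. *)

theory Defs
  imports "HOL-Probability.Probability" "HOL-Library.Landau_Symbols"
begin

definition cube :: "nat \<Rightarrow> nat \<Rightarrow> (nat \<Rightarrow> nat) set" where
  "cube n k = {1..k} \<rightarrow>\<^sub>E {1..n}"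

definition streams_of :: "nat \<Rightarrow> nat \<Rightarrow> nat \<Rightarrow> (nat \<Rightarrow> nat) list set" where
  "streams_of n m k = {xs. length xs = m \<and> set xs \<subseteq> cube n k}"

definition sqnorm :: "nat \<Rightarrow> nat \<Rightarrow> ((nat \<Rightarrow> nat) \<Rightarrow> real) \<Rightarrow> real" where
  "sqnorm n k u = (\<Sum>p\<in>cube n k. (u p)\<^sup>2)"

text \<open>
  Four-wise independence with uniform values. For \<open>card J = 4\<close> the probability is 1/16; sets of
  fewer than four points follow from this by marginalisation when \<open>n \<ge> 4\<close> (lemma
  \<open>four_wise_uniform_iff\<close> below) and have to be listed for \<open>n < 4\<close>, where there are no four
  distinct points.
\<close>
definition four_wise_uniform :: "'w measure \<Rightarrow> nat \<Rightarrow> ('w \<Rightarrow> nat \<Rightarrow> real) \<Rightarrow> bool" where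
  "four_wise_uniform M n f \<longleftrightarrow>
     (\<forall>J b. J \<subseteq> {1..n} \<longrightarrow> card J \<le> 4 \<longrightarrow> b ` J \<subseteq> {-1, 1} \<longrightarrow>
        measure M {\<omega> \<in> space M. \<forall>j\<in>J. f \<omega> j = b j} = (1/2) ^ card J)"

definition sign_functions :: "nat \<Rightarrow> (nat \<Rightarrow> real) measure" where
  "sign_functions n = PiM {1..n} (\<lambda>_. count_space {-1, 1})"

lemma sign_event_sets:
  assumes f: "f \<in> measurable M (sign_functions n)" and J: "J \<subseteq> {1..n}"
  shows "{\<omega> \<in> space M. \<forall>j\<in>J. f \<omega> j = b j} \<in> sets M"
proof (rule sets.sets_Collect_finite_All)
  show "finite J" using J finite_subset by blast
  fix j assume "j \<in> J"
  then have "(\<lambda>\<omega>. f \<omega> j) \<in> measurable M (count_space {-1, 1})"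
    using f J measurable_compose[OF f[unfolded sign_functions_def] measurable_component_singleton[of j]]
    by blast
  then have "(\<lambda>\<omega>. f \<omega> j) -` ({b j} \<inter> {-1, 1}) \<inter> space M \<in> sets M"
    by (rule measurable_sets) auto
  moreover have "(\<lambda>\<omega>. f \<omega> j) -` ({b j} \<inter> {-1, 1}) \<inter> space M = {\<omega> \<in> space M. f \<omega> j = b j}"
    using measurable_space[OF \<open>(\<lambda>\<omega>. f \<omega> j) \<in> measurable M (count_space {-1, 1})\<close>] by auto
  ultimately show "{\<omega> \<in> space M. f \<omega> j = b j} \<in> sets M" by simp
qed

lemma four_wise_uniform_iff:
  assumes "prob_space M" and f: "f \<in> measurable M (sign_functions n)" and n: "4 \<le> n"
  shows "four_wise_uniform M n f \<longleftrightarrow>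
    (\<forall>i\<^sub>1\<in>{1..n}. \<forall>i\<^sub>2\<in>{1..n}. \<forall>i\<^sub>3\<in>{1..n}. \<forall>i\<^sub>4\<in>{1..n}. distinct [i\<^sub>1, i\<^sub>2, i\<^sub>3, i\<^sub>4] \<longrightarrow>
      (\<forall>b\<^sub>1\<in>{-1, 1}. \<forall>b\<^sub>2\<in>{-1, 1}. \<forall>b\<^sub>3\<in>{-1, 1}. \<forall>b\<^sub>4\<in>{-1, 1}.
        measure M {\<omega> \<in> space M. f \<omega> i\<^sub>1 = b\<^sub>1 \<and> f \<omega> i\<^sub>2 = b\<^sub>2 \<and> f \<omega> i\<^sub>3 = b\<^sub>3 \<and> f \<omega> i\<^sub>4 = b\<^sub>4} = 1/16))"
    (is "_ \<longleftrightarrow> ?R")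
proof
  assume L: "four_wise_uniform M n f"
  show ?R
  proof (intro ballI impI)
    fix i1 i2 i3 i4 b1 b2 b3 b4
    assume i: "i1 \<in> {1..n}" "i2 \<in> {1..n}" "i3 \<in> {1..n}" "i4 \<in> {1..n}"
      and d: "distinct [i1, i2, i3, i4]"
      and b: "b1 \<in> {-1, 1::real}" "b2 \<in> {-1, 1::real}" "b3 \<in> {-1, 1::real}" "b4 \<in> {-1, 1::real}"
    define b where "b = ((\<lambda>_. b4)(i1 := b1, i2 := b2, i3 := b3))"
    have c: "card {i1, i2, i3, i4} = 4" using d by simp
    have "measure M {\<omega> \<in> space M. \<forall>j\<in>{i1, i2, i3, i4}. f \<omega> j = b j} = (1/2) ^ card {i1, i2, i3, i4}"
    proof (rule L[unfolded four_wise_uniform_def, rule_format])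
      show "{i1, i2, i3, i4} \<subseteq> {1..n}" using i by blast
      show "card {i1, i2, i3, i4} \<le> 4" using c by simp
      have "b j \<in> {-1, 1}" for j using b unfolding b_def fun_upd_def by presburger
      then show "b ` {i1, i2, i3, i4} \<subseteq> {-1, 1}" by blast
    qed
    moreover have "{\<omega> \<in> space M. \<forall>j\<in>{i1, i2, i3, i4}. f \<omega> j = b j} =
        {\<omega> \<in> space M. f \<omega> i1 = b1 \<and> f \<omega> i2 = b2 \<and> f \<omega> i3 = b3 \<and> f \<omega> i4 = b4}"
      using d unfolding b_def by simp
    ultimately show "measure M {\<omega> \<in> space M. f \<omega> i1 = b1 \<and> f \<omega> i2 = b2 \<and> f \<omega> i3 = b3 \<and> f \<omega> i4 = b4} = 1/16"
      using c by (simp add: power_one_over)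
  qed
next
  assume R: ?R
  interpret prob_space M by fact
  have *: "measure M {\<omega> \<in> space M. \<forall>j\<in>J. f \<omega> j = b j} = (1/2) ^ card J"
    if "J \<subseteq> {1..n}" "b ` J \<subseteq> {-1, 1}" "card J + d = 4" for J b d
    using that
  proof (induction d arbitrary: J b)
    case 0
    have "finite J" using 0 finite_subset by blast
    then obtain xs where xs: "set xs = J" "distinct xs" using finite_distinct_list by blast
    then have "length xs = Suc (Suc (Suc (Suc 0)))" using 0 distinct_card[of xs] by simp
    then obtain i1 i2 i3 i4 where "xs = [i1, i2, i3, i4]"
      by (auto simp: length_Suc_conv)
    with xs have J: "J = {i1, i2, i3, i4}" "distinct [i1, i2, i3, i4]" by auto
    have "measure M {\<omega> \<in> space M. f \<omega> i1 = b i1 \<and> f \<omega> i2 = b i2 \<and> f \<omega> i3 = b i3 \<and> f \<omega> i4 = b i4} = 1/16"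
      using R[rule_format, of i1 i2 i3 i4 "b i1" "b i2" "b i3" "b i4"] J 0 by simp
    then show ?case using J by (simp add: power_one_over)
  next
    case (Suc d)
    have fin: "finite J" using Suc.prems(1) finite_subset by blast
    have "J \<noteq> {1..n}" using Suc.prems(3) n by auto
    then obtain x where x: "x \<in> {1..n}" "x \<notin> J" using Suc.prems(1) by blast
    define E where "E s = {\<omega> \<in> space M. \<forall>j\<in>insert x J. f \<omega> j = (b(x := s)) j}" for s
    have E: "measure M (E s) = (1/2) ^ card (insert x J)" if "s \<in> {-1, 1}" for s
      unfolding E_def using Suc.prems x fin that by (intro Suc.IH) auto
    have S: "E s \<in> sets M" for s
      unfolding E_def by (rule sign_event_sets[OF f]) (use Suc.prems x in auto)
    have "f \<omega> x = -1 \<or> f \<omega> x = 1" if "\<omega> \<in> space M" for \<omega>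
      using measurable_space[OF f that] x by (auto simp: sign_functions_def space_PiM PiE_def Pi_def)
    then have "{\<omega> \<in> space M. \<forall>j\<in>J. f \<omega> j = b j} = E (-1) \<union> E 1"
      using x unfolding E_def by (auto split: if_splits)
    moreover have "E (-1) \<inter> E 1 = {}" unfolding E_def by auto
    ultimately have "measure M {\<omega> \<in> space M. \<forall>j\<in>J. f \<omega> j = b j} = measure M (E (-1)) + measure M (E 1)"
      using S by (simp add: finite_measure_Union)
    also have "\<dots> = (1/2) ^ card J" using E[of "-1"] E[of 1] x fin by simp
    finally show ?case .
  qed
  show "four_wise_uniform M n f"
    unfolding four_wise_uniform_def
  proof (intro allI impI)
    fix J b
    assume "J \<subseteq> {1..n}" "card J \<le> 4" "b ` J \<subseteq> {-1, 1::real}"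
    then show "measure M {\<omega> \<in> space M. \<forall>j\<in>J. f \<omega> j = b j} = (1/2) ^ card J"
      by (intro *[of J b "4 - card J"]) simp_all
  qed
qed

text \<open>
  \<open>h i \<omega>\<close> is the function drawn for coordinate \<open>i\<close>. Independence includes measurability into
  \<open>sign_functions n\<close>, so that \<open>h i \<omega> \<in> {1..n} \<rightarrow>\<^sub>E {-1, 1}\<close> for all \<open>\<omega> \<in> space M\<close>.
\<close>
definition random_signs :: "'w measure \<Rightarrow> nat \<Rightarrow> nat \<Rightarrow> (nat \<Rightarrow> 'w \<Rightarrow> nat \<Rightarrow> real) \<Rightarrow> bool" where
  "random_signs M n k h \<longleftrightarrow>
     prob_space M \<and>
     prob_space.indep_vars M (\<lambda>_. sign_functions n) h {1..k} \<and>
     (\<forall>i\<in>{1..k}. four_wise_uniform M n (h i))"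

definition prod_sign :: "nat \<Rightarrow> (nat \<Rightarrow> 'w \<Rightarrow> nat \<Rightarrow> real) \<Rightarrow> 'w \<Rightarrow> (nat \<Rightarrow> nat) \<Rightarrow> real" where
  "prod_sign k h \<omega> p = (\<Prod>i=1..k. h i \<omega> (p i))"

definition sketch :: "nat \<Rightarrow> nat \<Rightarrow> (nat \<Rightarrow> 'w \<Rightarrow> nat \<Rightarrow> real) \<Rightarrow> ((nat \<Rightarrow> nat) \<Rightarrow> real) \<Rightarrow> 'w \<Rightarrow> real" where
  "sketch n k h u \<omega> = (\<Sum>p\<in>cube n k. u p * prod_sign k h \<omega> p)\<^sup>2"

text \<open>
  A randomised one-pass algorithm with \<open>alg_bits\<close> bits of memory. Whatever it needs to remember
  between items, in particular random choices and the number of items read so far, has to be kept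
  in the memory.
\<close>
record 'i stream_alg =
  alg_bits :: nat
  alg_init :: "bool list pmf"
  alg_step :: "'i \<Rightarrow> bool list \<Rightarrow> bool list pmf"
  alg_out  :: "bool list \<Rightarrow> real"

definition streaming_algorithm :: "'i set \<Rightarrow> 'i stream_alg \<Rightarrow> bool" where
  "streaming_algorithm X A \<longleftrightarrow>
     set_pmf (alg_init A) \<subseteq> {w. length w = alg_bits A} \<and>
     (\<forall>x\<in>X. \<forall>w. length w = alg_bits A \<longrightarrow>
        set_pmf (alg_step A x w) \<subseteq> {w'. length w' = alg_bits A})"

definition alg_output :: "'i stream_alg \<Rightarrow> 'i list \<Rightarrow> real pmf" where
  "alg_output A xs =
     map_pmf (alg_out A) (foldl (\<lambda>W x. bind_pmf W (alg_step A x)) (alg_init A) xs)"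

text \<open>
  On every stream, the value computed by the algorithm has the same distribution as \<open>Y\<close>.
\<close>
definition maintains_instance ::
  "'w measure \<Rightarrow> 'i list set \<Rightarrow> ('i list \<Rightarrow> 'w \<Rightarrow> real) \<Rightarrow> 'i stream_alg \<Rightarrow> bool" where
  "maintains_instance M S Y A \<longleftrightarrow>
     (\<forall>xs\<in>S. \<forall>B. measure_pmf.prob (alg_output A xs) B = measure M {\<omega> \<in> space M. Y xs \<omega> \<in> B})"

type_synonym params = "nat \<times> nat \<times> nat \<times> real \<times> real"

text \<open>
  Asymptotic bounds in the parameters \<open>(n, m, k, \<epsilon>, \<delta>)\<close> hold with a constant that is uniform in all
  of them as long as \<open>\<delta>\<close> stays away from 1. A constant uniform up to \<open>\<delta> = 1\<close> cannot be had for
  a bound with the factor \<open>ln (1 / \<delta>)\<close>, which tends to 0 there.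
\<close>
definition param_bigo :: "(params \<Rightarrow> real) \<Rightarrow> (params \<Rightarrow> real) \<Rightarrow> bool" where
  "param_bigo f g \<longleftrightarrow>
     (\<forall>\<delta>\<^sub>0\<in>{0<..<1}.
        f \<in> O[principal {(n, m, k, \<epsilon>, \<delta>). 0 < n \<and> 0 < m \<and> 0 < k \<and> 0 < \<epsilon> \<and> \<epsilon> < 1 \<and> 0 < \<delta> \<and> \<delta> \<le> \<delta>\<^sub>0}](g))"

end

theory Submission
  imports Defs
begin

text \<open>
  The algorithm \<open>\<Lambda>\<close> outputs the median of \<open>O(ln (1 / \<delta>))\<close> means of \<open>O(3 ^ k / \<epsilon>\<^sup>2)\<close> independent copies of
  \<open>Y\<close>. Since the \<open>H p\<close> are pairwise orthogonal, \<open>Y\<close> has expectation \<open>\<parallel>v\<parallel>\<^sup>2\<close>. By 4-wise independence,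
  \<open>E (h a * h b * h c * h d)\<close> is bounded by the number of ways in which \<open>a, b, c, d\<close> can be grouped
  into two pairs of equal elements; as the coordinates are independent, \<open>E (Y\<^sup>2)\<close> is at most the
  \<open>k\<close>-fold tensor power of this form evaluated at \<open>\<bar>v\<bar>\<close>. Each of the three pairings has norm 1 by
  Cauchy-Schwarz and norms multiply under tensor products, so \<open>E (Y\<^sup>2) \<le> 3 ^ k * \<parallel>v\<parallel>\<^sup>4\<close>. Chebyshev's
  inequality makes each mean accurate with probability at least 3/4, and a Chernoff bound makes the
  median accurate with probability at least \<open>1 - \<delta>\<close>.
\<close>

section \<open>The pairing form\<close>

text \<open>The number of ways to split the four positions into two pairs of equal entries: 0, 1 or
  3. As a sum of indicators it turns multilinear sums into three products of inner products. The
  value 3 at four equal entries, where the expectation of the signs is 1, does no harm to an upper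
  bound.\<close>

definition pairings :: "'a \<Rightarrow> 'a \<Rightarrow> 'a \<Rightarrow> 'a \<Rightarrow> real" where
  "pairings a b c d = of_bool (a = b \<and> c = d) + of_bool (a = c \<and> b = d) + of_bool (a = d \<and> b = c)"

lemma pairings_nonneg: "0 \<le> pairings a b c d"
  unfolding pairings_def by (intro add_nonneg_nonneg zero_less_eq_of_bool)

text \<open>Peels off one coordinate, as needed for an induction over the coordinates of a tensor
  power.\<close>

lemma sum_PiE_insert:
  assumes "finite I" "x \<notin> I"
  shows "(\<Sum>p\<in>PiE (insert x I) (\<lambda>_. B). f p) = (\<Sum>j\<in>B. \<Sum>p\<in>PiE I (\<lambda>_. B). f (p(x := j)))"
proof -
  have "(\<Sum>p\<in>PiE (insert x I) (\<lambda>_. B). f p) =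
      sum f ((\<lambda>(y, g). g(x := y)) ` (B \<times> PiE I (\<lambda>_. B)))"
    by (simp only: PiE_insert_eq)
  also have "\<dots> = (\<Sum>(j, p)\<in>B \<times> PiE I (\<lambda>_. B). f (p(x := j)))"
    by (subst sum.reindex[OF inj_combinator[OF assms(2)]]) (simp only: case_prod_unfold o_def)
  finally show ?thesis by (simp only: sum.cartesian_product)
qed

text \<open>In each of the three pairings, two equalities collapse the four sums to two, which then
  separate into a product of two inner products.\<close>

lemma sum_pairings:
  fixes \<alpha> \<beta> \<gamma> \<delta> :: "'a \<Rightarrow> real"
  assumes "finite A"
  shows "(\<Sum>a\<in>A. \<Sum>b\<in>A. \<Sum>c\<in>A. \<Sum>d\<in>A. \<alpha> a * \<beta> b * \<gamma> c * \<delta> d * pairings a b c d) =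
    (\<Sum>a\<in>A. \<alpha> a * \<beta> a) * (\<Sum>a\<in>A. \<gamma> a * \<delta> a) +
    (\<Sum>a\<in>A. \<alpha> a * \<gamma> a) * (\<Sum>a\<in>A. \<beta> a * \<delta> a) +
    (\<Sum>a\<in>A. \<alpha> a * \<delta> a) * (\<Sum>a\<in>A. \<beta> a * \<gamma> a)"
proof -
  have d: "(\<Sum>y\<in>A. g y * of_bool (x = y)) = g x" if "x \<in> A" for x and g :: "'a \<Rightarrow> real"
  proof -
    have "(\<Sum>y\<in>A. g y * of_bool (x = y)) = (\<Sum>y\<in>A. if x = y then g y else 0)"
      by (intro sum.cong) auto
    then show ?thesis using assms that by simp
  qed
  have "(\<Sum>a\<in>A. \<Sum>b\<in>A. \<Sum>c\<in>A. \<Sum>d\<in>A. \<alpha> a * \<beta> b * \<gamma> c * \<delta> d * pairings a b c d) =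
      (\<Sum>a\<in>A. \<Sum>b\<in>A. \<Sum>c\<in>A. \<Sum>d\<in>A. \<alpha> a * \<beta> b * \<gamma> c * \<delta> d * of_bool (a = b) * of_bool (c = d)) +
      (\<Sum>a\<in>A. \<Sum>b\<in>A. \<Sum>c\<in>A. \<Sum>d\<in>A. \<alpha> a * \<beta> b * \<gamma> c * \<delta> d * of_bool (a = c) * of_bool (b = d)) +
      (\<Sum>a\<in>A. \<Sum>b\<in>A. \<Sum>c\<in>A. \<Sum>d\<in>A. \<alpha> a * \<beta> b * \<gamma> c * \<delta> d * of_bool (b = c) * of_bool (a = d))"
    unfolding pairings_def of_bool_conj by (simp add: distrib_left sum.distrib mult_ac)
  also have "(\<Sum>a\<in>A. \<Sum>b\<in>A. \<Sum>c\<in>A. \<Sum>d\<in>A. \<alpha> a * \<beta> b * \<gamma> c * \<delta> d * of_bool (a = b) * of_bool (c = d)) =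
      (\<Sum>a\<in>A. \<Sum>b\<in>A. \<Sum>c\<in>A. \<alpha> a * \<beta> b * \<gamma> c * \<delta> c * of_bool (a = b))"
    by (intro sum.cong refl) (simp add: d)
  \<comment> \<open>Here the remaining equality fixes \<open>b\<close>, which is not the innermost
    variable, so its indicator is first moved out of the sum over \<open>c\<close>.\<close>
  also have "\<dots> = (\<Sum>a\<in>A. \<Sum>b\<in>A. (\<Sum>c\<in>A. \<alpha> a * \<beta> b * \<gamma> c * \<delta> c) * of_bool (a = b))"
    by (simp add: sum_distrib_right)
  also have "\<dots> = (\<Sum>a\<in>A. \<Sum>c\<in>A. \<alpha> a * \<beta> a * \<gamma> c * \<delta> c)"
    by (intro sum.cong[OF refl] d)
  also have "\<dots> = (\<Sum>a\<in>A. \<alpha> a * \<beta> a) * (\<Sum>a\<in>A. \<gamma> a * \<delta> a)"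
    unfolding sum_product by (intro sum.cong refl) (simp only: mult_ac)
  also have "(\<Sum>a\<in>A. \<Sum>b\<in>A. \<Sum>c\<in>A. \<Sum>d\<in>A. \<alpha> a * \<beta> b * \<gamma> c * \<delta> d * of_bool (a = c) * of_bool (b = d)) =
      (\<Sum>a\<in>A. \<Sum>b\<in>A. \<Sum>c\<in>A. \<alpha> a * \<beta> b * \<gamma> c * \<delta> b * of_bool (a = c))"
    by (intro sum.cong refl) (simp add: d)
  also have "\<dots> = (\<Sum>a\<in>A. \<Sum>b\<in>A. \<alpha> a * \<beta> b * \<gamma> a * \<delta> b)"
    by (intro sum.cong refl) (simp add: d)
  also have "\<dots> = (\<Sum>a\<in>A. \<alpha> a * \<gamma> a) * (\<Sum>a\<in>A. \<beta> a * \<delta> a)"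
    unfolding sum_product by (intro sum.cong refl) (simp only: mult_ac)
  also have "(\<Sum>a\<in>A. \<Sum>b\<in>A. \<Sum>c\<in>A. \<Sum>d\<in>A. \<alpha> a * \<beta> b * \<gamma> c * \<delta> d * of_bool (b = c) * of_bool (a = d)) =
      (\<Sum>a\<in>A. \<Sum>b\<in>A. \<Sum>c\<in>A. \<alpha> a * \<beta> b * \<gamma> c * \<delta> a * of_bool (b = c))"
    by (intro sum.cong refl) (simp add: d)
  also have "\<dots> = (\<Sum>a\<in>A. \<Sum>b\<in>A. \<alpha> a * \<beta> b * \<gamma> b * \<delta> a)"
    by (intro sum.cong refl) (simp add: d)
  also have "\<dots> = (\<Sum>a\<in>A. \<alpha> a * \<delta> a) * (\<Sum>a\<in>A. \<beta> a * \<gamma> a)"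
    unfolding sum_product by (intro sum.cong refl) (simp only: mult_ac)
  finally show ?thesis .
qed

text \<open>The case of one coordinate: Cauchy-Schwarz bounds both inner products of each pairing,
  and all three pairings give the same product of norms.\<close>

lemma sum_pairings_le:
  fixes \<alpha> \<beta> \<gamma> \<delta> :: "'a \<Rightarrow> real"
  assumes "finite A"
  shows "(\<Sum>a\<in>A. \<Sum>b\<in>A. \<Sum>c\<in>A. \<Sum>d\<in>A. \<bar>\<alpha> a\<bar> * \<bar>\<beta> b\<bar> * \<bar>\<gamma> c\<bar> * \<bar>\<delta> d\<bar> * pairings a b c d)
    \<le> 3 * (L2_set \<alpha> A * L2_set \<beta> A * L2_set \<gamma> A * L2_set \<delta> A)"
proof -
  have *: "(\<Sum>a\<in>A. \<bar>f a\<bar> * \<bar>g a\<bar>) * (\<Sum>a\<in>A. \<bar>f' a\<bar> * \<bar>g' a\<bar>) \<le>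
     (L2_set f A * L2_set g A) * (L2_set f' A * L2_set g' A)" for f g f' g' :: "'a \<Rightarrow> real"
    by (intro mult_mono L2_set_mult_ineq mult_nonneg_nonneg L2_set_nonneg sum_nonneg) auto
  show ?thesis
    unfolding sum_pairings[OF assms]
    using *[of \<alpha> \<beta> \<gamma> \<delta>] *[of \<alpha> \<gamma> \<beta> \<delta>] *[of \<alpha> \<delta> \<beta> \<gamma>] by (simp add: mult_ac)
qed

text \<open>The norm of a function on a product is the norm of the function formed by the norms of
  its slices. This is what makes the bounds multiply in the induction.\<close>

lemma L2_set_PiE_insert:
  assumes "finite I" "x \<notin> I"
  shows "L2_set f (PiE (insert x I) (\<lambda>_. B)) =
    L2_set (\<lambda>j. L2_set (\<lambda>p. f (p(x := j))) (PiE I (\<lambda>_. B))) B"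
  unfolding L2_set_def sum_PiE_insert[OF assms] by (simp add: sum_nonneg)

text \<open>Induction on the coordinates. With the values at \<open>x\<close> fixed, the induction
  hypothesis bounds the sum over the other coordinates by slice norms; the inequality for one
  coordinate, applied to these norms, contributes the next factor 3. Four separate functions are
  required because the slices of one function at different values of \<open>x\<close>
  differ.\<close>

lemma sum_prod_pairings_le:
  fixes a b c d :: "('i \<Rightarrow> 'a) \<Rightarrow> real"
  assumes "finite I" and B: "finite B"
  defines "P \<equiv> \<lambda>I. PiE I (\<lambda>_. B)"
  shows "(\<Sum>p\<in>P I. \<Sum>q\<in>P I. \<Sum>r\<in>P I. \<Sum>s\<in>P I.
      \<bar>a p\<bar> * \<bar>b q\<bar> * \<bar>c r\<bar> * \<bar>d s\<bar> * (\<Prod>i\<in>I. pairings (p i) (q i) (r i) (s i)))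
    \<le> 3 ^ card I * (L2_set a (P I) * L2_set b (P I) * L2_set c (P I) * L2_set d (P I))"
  using assms(1)
proof (induction I arbitrary: a b c d rule: finite_induct)
  case empty
  then show ?case by (simp add: P_def)
next
  case (insert x I)
  define F where "F f j = (\<lambda>p. f (p(x := j)))" for f :: "('i \<Rightarrow> 'a) \<Rightarrow> real" and j
  define N where "N f j = L2_set (F f j) (P I)" for f j
  have S: "(\<Sum>p\<in>P (insert x I). f p) = (\<Sum>j\<in>B. \<Sum>p\<in>P I. f (p(x := j)))" for f :: "_ \<Rightarrow> real"
    unfolding P_def by (rule sum_PiE_insert) fact+
  have T: "L2_set f (P (insert x I)) = L2_set (N f) B" for f
    unfolding P_def N_def F_def by (rule L2_set_PiE_insert) fact+
  have W: "(\<Prod>i\<in>insert x I. pairings ((p(x := j)) i) ((q(x := l)) i) ((r(x := m)) i) ((s(x := o')) i)) =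
      pairings j l m o' * (\<Prod>i\<in>I. pairings (p i) (q i) (r i) (s i))" for p q r s j l m o'
    using insert.hyps by (auto intro!: prod.cong)
  have "(\<Sum>p\<in>P (insert x I). \<Sum>q\<in>P (insert x I). \<Sum>r\<in>P (insert x I). \<Sum>s\<in>P (insert x I).
      \<bar>a p\<bar> * \<bar>b q\<bar> * \<bar>c r\<bar> * \<bar>d s\<bar> * (\<Prod>i\<in>insert x I. pairings (p i) (q i) (r i) (s i)))
    = (\<Sum>j\<in>B. \<Sum>l\<in>B. \<Sum>m\<in>B. \<Sum>o'\<in>B. \<Sum>p\<in>P I. \<Sum>q\<in>P I. \<Sum>r\<in>P I. \<Sum>s\<in>P I.
      \<bar>F a j p\<bar> * \<bar>F b l q\<bar> * \<bar>F c m r\<bar> * \<bar>F d o' s\<bar> *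
        (pairings j l m o' * (\<Prod>i\<in>I. pairings (p i) (q i) (r i) (s i))))"
    unfolding S W F_def by (simp only: sum.swap[of _ B "P I"])
  also have "\<dots> = (\<Sum>j\<in>B. \<Sum>l\<in>B. \<Sum>m\<in>B. \<Sum>o'\<in>B. pairings j l m o' *
      (\<Sum>p\<in>P I. \<Sum>q\<in>P I. \<Sum>r\<in>P I. \<Sum>s\<in>P I.
        \<bar>F a j p\<bar> * \<bar>F b l q\<bar> * \<bar>F c m r\<bar> * \<bar>F d o' s\<bar> * (\<Prod>i\<in>I. pairings (p i) (q i) (r i) (s i))))"
    by (simp add: sum_distrib_left mult_ac)
  also have "\<dots> \<le> (\<Sum>j\<in>B. \<Sum>l\<in>B. \<Sum>m\<in>B. \<Sum>o'\<in>B. pairings j l m o' *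
      (3 ^ card I * (N a j * N b l * N c m * N d o')))"
    unfolding N_def
    by (rule sum_mono, rule sum_mono, rule sum_mono, rule sum_mono, rule mult_left_mono,
        rule insert.IH, rule pairings_nonneg)
  \<comment> \<open>The slice norms are nonnegative, so absolute values can be inserted to match
    \<open>sum_pairings_le\<close>.\<close>
  also have "\<dots> = 3 ^ card I * (\<Sum>j\<in>B. \<Sum>l\<in>B. \<Sum>m\<in>B. \<Sum>o'\<in>B.
      \<bar>N a j\<bar> * \<bar>N b l\<bar> * \<bar>N c m\<bar> * \<bar>N d o'\<bar> * pairings j l m o')"
    by (simp add: sum_distrib_left mult_ac N_def)
  also have "\<dots> \<le> 3 ^ card I * (3 * (L2_set (N a) B * L2_set (N b) B * L2_set (N c) B * L2_set (N d) B))"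
    by (rule mult_left_mono, rule sum_pairings_le, rule B) simp
  also have "\<dots> = 3 ^ card (insert x I) * (L2_set a (P (insert x I)) * L2_set b (P (insert x I)) *
      L2_set c (P (insert x I)) * L2_set d (P (insert x I)))"
    using insert.hyps by (simp add: T)
  finally show ?case .
qed

section \<open>Moments of the sketch\<close>

lemma sign_measurable:
  assumes "f \<in> measurable M (sign_functions n)" "j \<in> {1..n}"
  shows "(\<lambda>\<omega>. f \<omega> j) \<in> borel_measurable M"
proof -
  have "(\<lambda>\<omega>. f \<omega> j) \<in> measurable M (count_space {-1, 1})"
    using measurable_compose[OF assms(1)[unfolded sign_functions_def] measurable_component_singleton[OF assms(2)]] .
  moreover have "(\<lambda>x. x) \<in> measurable (count_space {-1, 1}) borel" by simp
  ultimately show ?thesis by (rule measurable_compose)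
qed

lemma sign_values:
  assumes "f \<in> measurable M (sign_functions n)" "j \<in> {1..n}" "\<omega> \<in> space M"
  shows "f \<omega> j \<in> {-1, 1}"
  using measurable_space[OF assms(1,3)] assms(2)
  by (auto simp: sign_functions_def space_PiM PiE_def Pi_def)

text \<open>All sign patterns on \<open>J\<close> are equally likely, so the expectation is a
  multiple of the sum of \<open>\<Prod>j\<in>J. b j\<close> over all patterns \<open>b\<close>. This
  sum factors into one factor (-1) + 1 for each element of the nonempty set
  \<open>J\<close>.\<close>

lemma expectation_prod_signs_eq_0:
  assumes "prob_space M" and f: "f \<in> measurable M (sign_functions n)" and four: "four_wise_uniform M n f"
    and J: "J \<subseteq> {1..n}" "card J \<le> 4" "J \<noteq> {}"
  shows "(\<integral>\<omega>. (\<Prod>j\<in>J. f \<omega> j) \<partial>M) = 0"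
proof -
  interpret prob_space M by fact
  have fin: "finite J" using J finite_subset by blast
  let ?P = "PiE J (\<lambda>_. {-1, 1 :: real})"
  let ?E = "\<lambda>b. {\<omega> \<in> space M. \<forall>j\<in>J. f \<omega> j = b j}"
  have finP: "finite ?P" using fin by (intro finite_PiE) auto
  \<comment> \<open>At each \<omega> exactly one pattern occurs, the restriction of
    \<open>f \<omega>\<close> to \<open>J\<close>, so only its indicator contributes.\<close>
  have *: "(\<Prod>j\<in>J. f \<omega> j) = (\<Sum>b\<in>?P. (\<Prod>j\<in>J. b j) * indicator (?E b) \<omega>)" if \<omega>: "\<omega> \<in> space M" for \<omega>
  proof -
    let ?r = "restrict (f \<omega>) J"
    have r: "?r \<in> ?P" unfolding restrict_PiE_iff using sign_values[OF f _ \<omega>] J(1) by blast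
    have "(\<Prod>j\<in>J. b j) * indicator (?E b) \<omega> = (if b = ?r then \<Prod>j\<in>J. b j else 0)" if "b \<in> ?P" for b
    proof -
      have "\<omega> \<in> ?E b \<longleftrightarrow> b = ?r"
        using \<omega> PiE_arb[OF that] by (auto simp: restrict_def fun_eq_iff)
      then show ?thesis by (simp add: indicator_def)
    qed
    then have "(\<Sum>b\<in>?P. (\<Prod>j\<in>J. b j) * indicator (?E b) \<omega>) = (\<Sum>b\<in>?P. if b = ?r then \<Prod>j\<in>J. b j else 0)"
      by (rule sum.cong[OF refl])
    also have "\<dots> = (\<Prod>j\<in>J. ?r j)" using r finP by simp
    finally show ?thesis by simp
  qed
  have "(\<integral>\<omega>. (\<Prod>j\<in>J. f \<omega> j) \<partial>M) = (\<integral>\<omega>. (\<Sum>b\<in>?P. (\<Prod>j\<in>J. b j) * indicator (?E b) \<omega>) \<partial>M)"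
    by (rule Bochner_Integration.integral_cong[OF refl]) (rule *)
  also have "\<dots> = (\<Sum>b\<in>?P. (\<Prod>j\<in>J. b j) * measure M (?E b))"
  proof (subst Bochner_Integration.integral_sum)
    fix b
    have S: "?E b \<in> sets M" by (rule sign_event_sets[OF f J(1)])
    then show "integrable M (\<lambda>\<omega>. (\<Prod>j\<in>J. b j) * indicator (?E b) \<omega>)"
      by (intro integrable_mult_right integrable_real_indicator) (auto simp: emeasure_eq_measure)
  qed (simp add: Int_absorb2 Collect_restrict)
  also have "\<dots> = (\<Sum>b\<in>?P. (\<Prod>j\<in>J. b j) * (1 / 2) ^ card J)"
  proof (rule sum.cong[OF refl])
    fix b assume "b \<in> ?P"
    then have "b ` J \<subseteq> {-1, 1}" by auto
    then show "(\<Prod>j\<in>J. b j) * measure M (?E b) = (\<Prod>j\<in>J. b j) * (1 / 2) ^ card J"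
      using four J unfolding four_wise_uniform_def by simp
  qed
  also have "\<dots> = (\<Prod>j\<in>J. \<Sum>y\<in>{-1, 1 :: real}. y) * (1 / 2) ^ card J"
    using fin by (subst prod_sum_PiE) (simp_all add: sum_distrib_right)
  also have "\<dots> = 0" using fin J by (simp add: card_gt_0_iff)
  finally show ?thesis .
qed

lemma expectation_two_signs:
  assumes "prob_space M" and f: "f \<in> measurable M (sign_functions n)" and four: "four_wise_uniform M n f"
    and ab: "a \<in> {1..n}" "b \<in> {1..n}"
  shows "(\<integral>\<omega>. f \<omega> a * f \<omega> b \<partial>M) = of_bool (a = b)"
proof (cases "a = b")
  case True
  interpret prob_space M by fact
  have "(\<integral>\<omega>. f \<omega> a * f \<omega> b \<partial>M) = (\<integral>\<omega>. 1 \<partial>M)"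
    using sign_values[OF f ab(1)] True by (intro Bochner_Integration.integral_cong refl) fastforce
  then show ?thesis using True prob_space by simp
next
  case False
  have "(\<integral>\<omega>. (\<Prod>j\<in>{a, b}. f \<omega> j) \<partial>M) = 0"
    using ab False by (intro expectation_prod_signs_eq_0[OF assms(1) f four]) auto
  then show ?thesis using False by simp
qed

text \<open>If some pairing matches, the trivial bound 1 suffices. Otherwise the expectation
  vanishes: either the four points are distinct, or two equal ones cancel because signs square to 1
  and the other two differ.\<close>

lemma expectation_four_signs_le:
  assumes "prob_space M" and f: "f \<in> measurable M (sign_functions n)" and four: "four_wise_uniform M n f"
    and I: "a \<in> {1..n}" "b \<in> {1..n}" "c \<in> {1..n}" "d \<in> {1..n}"
  shows "\<bar>\<integral>\<omega>. f \<omega> a * f \<omega> b * f \<omega> c * f \<omega> d \<partial>M\<bar> \<le> pairings a b c d"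
proof -
  interpret prob_space M by fact
  note val = sign_values[OF f]
  \<comment> \<open>The cases may overlap, for instance when exactly three of the points are equal;
    only exhaustiveness matters.\<close>
  consider (paired) "a = b \<and> c = d \<or> a = c \<and> b = d \<or> a = d \<and> b = c"
    | (distinct) "distinct [a, b, c, d]"
    | (ab) "a = b" "c \<noteq> d" | (cd) "c = d" "a \<noteq> b"
    | (ac) "a = c" "b \<noteq> d" | (bd) "b = d" "a \<noteq> c"
    | (ad) "a = d" "b \<noteq> c" | (bc) "b = c" "a \<noteq> d"
    by auto
  then show ?thesis
  proof cases
    case paired
    have "\<bar>\<integral>\<omega>. f \<omega> a * f \<omega> b * f \<omega> c * f \<omega> d \<partial>M\<bar> \<le> (\<integral>\<omega>. \<bar>f \<omega> a * f \<omega> b * f \<omega> c * f \<omega> d\<bar> \<partial>M)"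
      by (rule integral_abs_bound)
    also have "\<dots> = (\<integral>\<omega>. 1 \<partial>M)"
      using val[OF I(1)] val[OF I(2)] val[OF I(3)] val[OF I(4)]
      by (intro Bochner_Integration.integral_cong refl) (fastforce simp: abs_mult)
    also have "\<dots> = 1" using prob_space by simp
    also have "\<dots> \<le> pairings a b c d"
      using paired by (auto simp: pairings_def)
    finally show ?thesis .
  next
    case distinct
    have "(\<integral>\<omega>. (\<Prod>j\<in>{a, b, c, d}. f \<omega> j) \<partial>M) = 0"
      using I distinct by (intro expectation_prod_signs_eq_0[OF assms(1) f four]) auto
    then show ?thesis using distinct pairings_nonneg[of a b c d] by (simp add: mult.assoc)
  next
    case ab
    have "(\<integral>\<omega>. f \<omega> a * f \<omega> b * f \<omega> c * f \<omega> d \<partial>M) = (\<integral>\<omega>. f \<omega> c * f \<omega> d \<partial>M)"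
      using val[OF I(1)] ab by (intro Bochner_Integration.integral_cong refl) fastforce
    then show ?thesis
      using expectation_two_signs[OF assms(1) f four I(3,4)] ab pairings_nonneg[of a b c d] by simp
  next
    case cd
    have "(\<integral>\<omega>. f \<omega> a * f \<omega> b * f \<omega> c * f \<omega> d \<partial>M) = (\<integral>\<omega>. f \<omega> a * f \<omega> b \<partial>M)"
      using val[OF I(3)] cd by (intro Bochner_Integration.integral_cong refl) fastforce
    then show ?thesis
      using expectation_two_signs[OF assms(1) f four I(1,2)] cd pairings_nonneg[of a b c d] by simp
  next
    case ac
    have "(\<integral>\<omega>. f \<omega> a * f \<omega> b * f \<omega> c * f \<omega> d \<partial>M) = (\<integral>\<omega>. f \<omega> b * f \<omega> d \<partial>M)"
      using val[OF I(1)] ac by (intro Bochner_Integration.integral_cong refl) fastforce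
    then show ?thesis
      using expectation_two_signs[OF assms(1) f four I(2,4)] ac pairings_nonneg[of a b c d] by simp
  next
    case bd
    have "(\<integral>\<omega>. f \<omega> a * f \<omega> b * f \<omega> c * f \<omega> d \<partial>M) = (\<integral>\<omega>. f \<omega> a * f \<omega> c \<partial>M)"
      using val[OF I(2)] bd by (intro Bochner_Integration.integral_cong refl) fastforce
    then show ?thesis
      using expectation_two_signs[OF assms(1) f four I(1,3)] bd pairings_nonneg[of a b c d] by simp
  next
    case ad
    have "(\<integral>\<omega>. f \<omega> a * f \<omega> b * f \<omega> c * f \<omega> d \<partial>M) = (\<integral>\<omega>. f \<omega> b * f \<omega> c \<partial>M)"
      using val[OF I(1)] ad by (intro Bochner_Integration.integral_cong refl) fastforce
    then show ?thesis
      using expectation_two_signs[OF assms(1) f four I(2,3)] ad pairings_nonneg[of a b c d] by simp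
  next
    case bc
    have "(\<integral>\<omega>. f \<omega> a * f \<omega> b * f \<omega> c * f \<omega> d \<partial>M) = (\<integral>\<omega>. f \<omega> a * f \<omega> d \<partial>M)"
      using val[OF I(2)] bc by (intro Bochner_Integration.integral_cong refl) fastforce
    then show ?thesis
      using expectation_two_signs[OF assms(1) f four I(1,4)] bc pairings_nonneg[of a b c d] by simp
  qed
qed

section \<open>Products over independent coordinates\<close>

lemma random_signs_measurable:
  assumes "random_signs M n k h" "i \<in> {1..k}"
  shows "h i \<in> measurable M (sign_functions n)"
proof -
  interpret prob_space M using assms by (simp add: random_signs_def)
  show ?thesis using assms by (auto simp: random_signs_def indep_vars_def)
qed

text \<open>Independence of the \<open>h i\<close> is inherited by functions of each
  \<open>h i\<close> alone, and the bound by 1 supplies the integrability required for factoring the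
  expectation.\<close>

lemma expectation_prod_coordinates:
  fixes g :: "nat \<Rightarrow> (nat \<Rightarrow> real) \<Rightarrow> real"
  assumes R: "random_signs M n k h"
    and g: "\<And>i. i \<in> {1..k} \<Longrightarrow> g i \<in> borel_measurable (sign_functions n)"
    and bound: "\<And>i f. i \<in> {1..k} \<Longrightarrow> f \<in> space (sign_functions n) \<Longrightarrow> \<bar>g i f\<bar> \<le> 1"
  shows "(\<integral>\<omega>. (\<Prod>i=1..k. g i (h i \<omega>)) \<partial>M) = (\<Prod>i=1..k. \<integral>\<omega>. g i (h i \<omega>) \<partial>M)"
    and "integrable M (\<lambda>\<omega>. \<Prod>i=1..k. g i (h i \<omega>))"
proof -
  interpret prob_space M using R by (simp add: random_signs_def)
  have "indep_vars (\<lambda>_. sign_functions n) h {1..k}" using R by (simp add: random_signs_def)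
  then have ind: "indep_vars (\<lambda>_. borel) (\<lambda>i \<omega>. g i (h i \<omega>)) {1..k}"
    by (rule indep_vars_compose2) (rule g)
  have int: "integrable M (\<lambda>\<omega>. g i (h i \<omega>))" if i: "i \<in> {1..k}" for i
  proof (rule integrable_const_bound[of _ 1])
    note m = random_signs_measurable[OF R i]
    show "AE \<omega> in M. norm (g i (h i \<omega>)) \<le> 1"
      using bound[OF i measurable_space[OF m]] by simp
    show "(\<lambda>\<omega>. g i (h i \<omega>)) \<in> borel_measurable M"
      using measurable_compose[OF m g[OF i]] .
  qed
  show "(\<integral>\<omega>. (\<Prod>i=1..k. g i (h i \<omega>)) \<partial>M) = (\<Prod>i=1..k. \<integral>\<omega>. g i (h i \<omega>) \<partial>M)"
    by (rule indep_vars_lebesgue_integral[OF _ ind int]) auto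
  show "integrable M (\<lambda>\<omega>. \<Prod>i=1..k. g i (h i \<omega>))"
    by (rule indep_vars_integrable[OF _ ind int]) auto
qed

lemma sign_functions_coordinate:
  assumes "j \<in> {1..n}"
  shows "(\<lambda>f. f j) \<in> borel_measurable (sign_functions n)"
    and "f \<in> space (sign_functions n) \<Longrightarrow> \<bar>f j\<bar> = 1"
proof -
  have id: "(\<lambda>f. f) \<in> measurable (sign_functions n) (sign_functions n)" by simp
  show "(\<lambda>f. f j) \<in> borel_measurable (sign_functions n)"
    by (rule sign_measurable[OF id assms])
  show "f \<in> space (sign_functions n) \<Longrightarrow> \<bar>f j\<bar> = 1"
    using sign_values[OF id assms, of f] by auto
qed

lemma cube_coordinate: "p \<in> cube n k \<Longrightarrow> i \<in> {1..k} \<Longrightarrow> p i \<in> {1..n}"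
  by (auto simp: cube_def)

lemma finite_cube [simp]: "finite (cube n k)"
  unfolding cube_def by (intro finite_PiE) auto

text \<open>Orthonormality of the product signs: the expectation factors over the coordinates, and a
  single differing coordinate makes it vanish.\<close>

lemma expectation_two_prod_signs:
  assumes R: "random_signs M n k h" and pq: "p \<in> cube n k" "q \<in> cube n k"
  shows "(\<integral>\<omega>. prod_sign k h \<omega> p * prod_sign k h \<omega> q \<partial>M) = of_bool (p = q)"
    and "integrable M (\<lambda>\<omega>. prod_sign k h \<omega> p * prod_sign k h \<omega> q)"
proof -
  let ?g = "\<lambda>i f. f (p i) * f (q i)"
  have E: "prod_sign k h \<omega> p * prod_sign k h \<omega> q = (\<Prod>i=1..k. ?g i (h i \<omega>))" for \<omega>
    by (simp add: prod_sign_def prod.distrib)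
  have g: "?g i \<in> borel_measurable (sign_functions n)"
    and b: "f \<in> space (sign_functions n) \<Longrightarrow> \<bar>?g i f\<bar> \<le> 1" if "i \<in> {1..k}" for i f
    using sign_functions_coordinate[OF cube_coordinate[OF pq(1) that]]
      sign_functions_coordinate[OF cube_coordinate[OF pq(2) that]]
    by (auto simp: abs_mult intro!: borel_measurable_times)
  note F = expectation_prod_coordinates[where g = ?g, OF R]
  \<comment> \<open>Points of the cube are extensional functions, so agreement on
    \<open>{1..k}\<close> is equality.\<close>
  have "p = q \<longleftrightarrow> (\<forall>i\<in>{1..k}. p i = q i)"
    using pq unfolding cube_def by (metis PiE_ext)
  then have "(\<Prod>i=1..k. of_bool (p i = q i)) = (of_bool (p = q) :: real)"
    by (auto simp: prod_zero_iff)
  moreover have "(\<integral>\<omega>. ?g i (h i \<omega>) \<partial>M) = of_bool (p i = q i)" if "i \<in> {1..k}" for i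
    using R random_signs_measurable[OF R that] that cube_coordinate[OF pq(1) that] cube_coordinate[OF pq(2) that]
    by (intro expectation_two_signs[of M "h i" n]) (auto simp: random_signs_def)
  ultimately show "(\<integral>\<omega>. prod_sign k h \<omega> p * prod_sign k h \<omega> q \<partial>M) = of_bool (p = q)"
    unfolding E by (subst F(1)) (use g b in auto)
  show "integrable M (\<lambda>\<omega>. prod_sign k h \<omega> p * prod_sign k h \<omega> q)"
    unfolding E by (rule F(2)) (use g b in auto)
qed

text \<open>The bound for one coordinate multiplies over the independent coordinates, which yields
  the kernel of the tensor power in \<open>sum_prod_pairings_le\<close>.\<close>

lemma expectation_four_prod_signs_le:
  assumes R: "random_signs M n k h"
    and P: "p \<in> cube n k" "q \<in> cube n k" "r \<in> cube n k" "s \<in> cube n k"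
  defines "H \<equiv> prod_sign k h"
  shows "\<bar>\<integral>\<omega>. H \<omega> p * H \<omega> q * H \<omega> r * H \<omega> s \<partial>M\<bar> \<le> (\<Prod>i=1..k. pairings (p i) (q i) (r i) (s i))"
    and "integrable M (\<lambda>\<omega>. H \<omega> p * H \<omega> q * H \<omega> r * H \<omega> s)"
proof -
  let ?g = "\<lambda>i f. f (p i) * f (q i) * f (r i) * f (s i)"
  have E: "H \<omega> p * H \<omega> q * H \<omega> r * H \<omega> s = (\<Prod>i=1..k. ?g i (h i \<omega>))" for \<omega>
    by (simp add: H_def prod_sign_def prod.distrib)
  have g: "?g i \<in> borel_measurable (sign_functions n)"
    and b: "f \<in> space (sign_functions n) \<Longrightarrow> \<bar>?g i f\<bar> \<le> 1" if "i \<in> {1..k}" for i f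
    using sign_functions_coordinate[OF cube_coordinate[OF P(1) that]]
      sign_functions_coordinate[OF cube_coordinate[OF P(2) that]]
      sign_functions_coordinate[OF cube_coordinate[OF P(3) that]]
      sign_functions_coordinate[OF cube_coordinate[OF P(4) that]]
    by (auto simp: abs_mult intro!: borel_measurable_times)
  note F = expectation_prod_coordinates[where g = ?g, OF R]
  have *: "\<bar>\<integral>\<omega>. ?g i (h i \<omega>) \<partial>M\<bar> \<le> pairings (p i) (q i) (r i) (s i)" if i: "i \<in> {1..k}" for i
    using R that by (intro expectation_four_signs_le[OF _ random_signs_measurable[OF R i]] cube_coordinate[OF _ i] P)
      (auto simp: random_signs_def)
  have "(\<integral>\<omega>. (\<Prod>i=1..k. ?g i (h i \<omega>)) \<partial>M) = (\<Prod>i=1..k. \<integral>\<omega>. ?g i (h i \<omega>) \<partial>M)"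
    by (rule F(1)) (use g b in auto)
  then show "\<bar>\<integral>\<omega>. H \<omega> p * H \<omega> q * H \<omega> r * H \<omega> s \<partial>M\<bar> \<le> (\<Prod>i=1..k. pairings (p i) (q i) (r i) (s i))"
    unfolding E using * by (simp only: abs_prod) (intro prod_mono, auto)
  show "integrable M (\<lambda>\<omega>. H \<omega> p * H \<omega> q * H \<omega> r * H \<omega> s)"
    unfolding E by (rule F(2)) (use g b in auto)
qed

text \<open>After the square is expanded, orthonormality leaves only the diagonal terms.\<close>

lemma expectation_sketch:
  assumes R: "random_signs M n k h"
  shows "(\<integral>\<omega>. sketch n k h u \<omega> \<partial>M) = sqnorm n k u"
    and "integrable M (sketch n k h u)"
proof -
  let ?H = "prod_sign k h"
  have E: "sketch n k h u = (\<lambda>\<omega>. \<Sum>p\<in>cube n k. \<Sum>q\<in>cube n k. (u p * u q) * (?H \<omega> p * ?H \<omega> q))"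
    unfolding sketch_def power2_eq_square sum_product by (simp only: mult_ac)
  note int = expectation_two_prod_signs(2)[OF R]
  show "integrable M (sketch n k h u)" unfolding E
    by (intro Bochner_Integration.integrable_sum integrable_mult_right int)
  have "(\<integral>\<omega>. sketch n k h u \<omega> \<partial>M) =
      (\<Sum>p\<in>cube n k. \<Sum>q\<in>cube n k. (u p * u q) * (\<integral>\<omega>. ?H \<omega> p * ?H \<omega> q \<partial>M))"
    unfolding E using int by (simp add: Bochner_Integration.integral_sum)
  also have "\<dots> = (\<Sum>p\<in>cube n k. \<Sum>q\<in>cube n k. if p = q then u p * u q else 0)"
    by (intro sum.cong refl) (simp add: expectation_two_prod_signs(1)[OF R])
  also have "\<dots> = sqnorm n k u"
    by (simp add: sqnorm_def power2_eq_square)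
  finally show "(\<integral>\<omega>. sketch n k h u \<omega> \<partial>M) = sqnorm n k u" .
qed

text \<open>The expanded fourth power is bounded term by term in absolute value, and
  \<open>sum_prod_pairings_le\<close> is applied with all four functions equal to \<open>u\<close>.
  The fourth power of the norm of \<open>u\<close> is the square of
  \<open>sqnorm n k u\<close>.\<close>

lemma expectation_sketch_square_le:
  assumes R: "random_signs M n k h"
  shows "(\<integral>\<omega>. (sketch n k h u \<omega>)\<^sup>2 \<partial>M) \<le> 3 ^ k * (sqnorm n k u)\<^sup>2"
    and "integrable M (\<lambda>\<omega>. (sketch n k h u \<omega>)\<^sup>2)"
proof -
  let ?H = "prod_sign k h" and ?C = "cube n k"
  have E: "(sketch n k h u \<omega>)\<^sup>2 = (\<Sum>p\<in>?C. \<Sum>q\<in>?C. \<Sum>r\<in>?C. \<Sum>s\<in>?C.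
      (u p * u q * u r * u s) * (?H \<omega> p * ?H \<omega> q * ?H \<omega> r * ?H \<omega> s))" for \<omega>
  proof -
    define X where "X p = u p * ?H \<omega> p" for p
    have "(sketch n k h u \<omega>)\<^sup>2 = sum X ?C * (sum X ?C * (sum X ?C * sum X ?C))"
      unfolding sketch_def X_def by (simp only: power2_eq_square mult.assoc)
    also have "\<dots> = (\<Sum>p\<in>?C. \<Sum>q\<in>?C. \<Sum>r\<in>?C. \<Sum>s\<in>?C. X p * (X q * (X r * X s)))"
      by (simp only: sum_distrib_left[symmetric] sum_distrib_right[symmetric])
    finally show ?thesis by (simp only: X_def mult_ac)
  qed
  note int = expectation_four_prod_signs_le(2)[OF R]
  show "integrable M (\<lambda>\<omega>. (sketch n k h u \<omega>)\<^sup>2)" unfolding E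
    by (intro Bochner_Integration.integrable_sum integrable_mult_right int)
  have "(\<integral>\<omega>. (sketch n k h u \<omega>)\<^sup>2 \<partial>M) = (\<Sum>p\<in>?C. \<Sum>q\<in>?C. \<Sum>r\<in>?C. \<Sum>s\<in>?C.
      (u p * u q * u r * u s) * (\<integral>\<omega>. ?H \<omega> p * ?H \<omega> q * ?H \<omega> r * ?H \<omega> s \<partial>M))"
    unfolding E using int by (simp add: Bochner_Integration.integral_sum)
  also have "\<dots> \<le> (\<Sum>p\<in>?C. \<Sum>q\<in>?C. \<Sum>r\<in>?C. \<Sum>s\<in>?C.
      \<bar>u p\<bar> * \<bar>u q\<bar> * \<bar>u r\<bar> * \<bar>u s\<bar> * (\<Prod>i=1..k. pairings (p i) (q i) (r i) (s i)))"
  proof (intro sum_mono)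
    fix p q r s assume P: "p \<in> ?C" "q \<in> ?C" "r \<in> ?C" "s \<in> ?C"
    let ?I = "\<integral>\<omega>. ?H \<omega> p * ?H \<omega> q * ?H \<omega> r * ?H \<omega> s \<partial>M"
    have "(u p * u q * u r * u s) * ?I \<le> \<bar>u p\<bar> * \<bar>u q\<bar> * \<bar>u r\<bar> * \<bar>u s\<bar> * \<bar>?I\<bar>"
      using abs_ge_self[of "(u p * u q * u r * u s) * ?I"] by (simp add: abs_mult)
    also have "\<dots> \<le> \<bar>u p\<bar> * \<bar>u q\<bar> * \<bar>u r\<bar> * \<bar>u s\<bar> * (\<Prod>i=1..k. pairings (p i) (q i) (r i) (s i))"
      by (intro mult_left_mono expectation_four_prod_signs_le(1)[OF R P]) simp
    finally show "(u p * u q * u r * u s) * ?I \<le>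
      \<bar>u p\<bar> * \<bar>u q\<bar> * \<bar>u r\<bar> * \<bar>u s\<bar> * (\<Prod>i=1..k. pairings (p i) (q i) (r i) (s i))" .
  qed
  also have "\<dots> \<le> 3 ^ card {1..k} * (L2_set u ?C * L2_set u ?C * L2_set u ?C * L2_set u ?C)"
    unfolding cube_def by (rule sum_prod_pairings_le) auto
  also have "\<dots> = 3 ^ k * ((L2_set u ?C)\<^sup>2)\<^sup>2"
    by (simp add: power2_eq_square)
  also have "(L2_set u ?C)\<^sup>2 = sqnorm n k u"
    by (simp add: L2_set_def sqnorm_def sum_nonneg)
  finally show "(\<integral>\<omega>. (sketch n k h u \<omega>)\<^sup>2 \<partial>M) \<le> 3 ^ k * (sqnorm n k u)\<^sup>2" .
qed

text \<open>The value depends only on the signs attached to the finitely many points of the cube.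
  Finiteness allows the comparison with the discrete output distribution of an algorithm.\<close>

lemma finite_range_sketch:
  assumes R: "random_signs M n k h"
  shows "finite (sketch n k h u ` space M)"
proof (rule finite_subset)
  let ?S = "PiE (cube n k) (\<lambda>_. {-1, 1 :: real})"
  show "finite ((\<lambda>s. (\<Sum>p\<in>cube n k. u p * s p)\<^sup>2) ` ?S)"
    by (intro finite_imageI finite_PiE) auto
  show "sketch n k h u ` space M \<subseteq> (\<lambda>s. (\<Sum>p\<in>cube n k. u p * s p)\<^sup>2) ` ?S"
  proof (rule image_subsetI)
    fix \<omega> assume \<omega>: "\<omega> \<in> space M"
    have "\<bar>prod_sign k h \<omega> p\<bar> = 1" if p: "p \<in> cube n k" for p
    proof -
      have "\<bar>h i \<omega> (p i)\<bar> = 1" if "i \<in> {1..k}" for i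
        using sign_values[OF random_signs_measurable[OF R that] cube_coordinate[OF p that] \<omega>] by auto
      then show ?thesis by (simp add: prod_sign_def abs_prod)
    qed
    then have "restrict (prod_sign k h \<omega>) (cube n k) \<in> ?S"
      unfolding restrict_PiE_iff by (auto simp: abs_eq_iff')
    moreover have "sketch n k h u \<omega> = (\<Sum>p\<in>cube n k. u p * restrict (prod_sign k h \<omega>) (cube n k) p)\<^sup>2"
      by (simp add: sketch_def)
    ultimately show "sketch n k h u \<omega> \<in> (\<lambda>s. (\<Sum>p\<in>cube n k. u p * s p)\<^sup>2) ` ?S" by blast
  qed
qed

text \<open>A measurable function with finite range is measurable even into the discrete
  \<sigma>-algebra. The hypothesis on all sets \<open>B\<close> then identifies \<open>p\<close>
  with the distribution of \<open>Y\<close>, and expectations transfer.\<close>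

lemma expectation_pmf_eq_integral:
  fixes Y :: "'w \<Rightarrow> real" and f :: "real \<Rightarrow> real"
  assumes "prob_space M" and Y: "Y \<in> borel_measurable M" "finite (Y ` space M)"
    and p: "\<And>B. measure_pmf.prob p B = measure M {\<omega> \<in> space M. Y \<omega> \<in> B}"
  shows "measure_pmf.expectation p f = (\<integral>\<omega>. f (Y \<omega>) \<partial>M)"
proof -
  interpret prob_space M by fact
  have Y': "Y \<in> measurable M (count_space UNIV)"
    using Y by (intro measurable_simple_function simple_function_borel_measurable)
  have "measure_pmf p = distr M (count_space UNIV) Y"
  proof (rule measure_eqI)
    fix B
    have "Y -` B \<inter> space M = {\<omega> \<in> space M. Y \<omega> \<in> B}" by auto
    then show "emeasure (measure_pmf p) B = emeasure (distr M (count_space UNIV) Y) B"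
      using Y' by (simp add: emeasure_distr measure_pmf.emeasure_eq_measure emeasure_eq_measure p)
  qed simp
  then show ?thesis using Y' by (simp add: integral_distr)
qed

section \<open>Independent copies of a streaming algorithm\<close>

text \<open>Independent draws from possibly different distributions: copies of an algorithm that are
  in different states have different transition distributions.\<close>

fun seq_pmf :: "'a pmf list \<Rightarrow> 'a list pmf" where
  "seq_pmf [] = return_pmf []"
| "seq_pmf (p # ps) = bind_pmf p (\<lambda>x. map_pmf ((#) x) (seq_pmf ps))"

text \<open>The number of blocks is an argument because the word does not determine it when the
  block length \<open>b\<close> is 0.\<close>

fun chunks :: "nat \<Rightarrow> nat \<Rightarrow> 'a list \<Rightarrow> 'a list list" where
  "chunks b 0 w = []"
| "chunks b (Suc s) w = take b w # chunks b s (drop b w)"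

lemma chunks_concat:
  "length ws = s \<Longrightarrow> \<forall>w\<in>set ws. length w = b \<Longrightarrow> chunks b s (concat ws) = ws"
  by (induction ws arbitrary: s) auto

lemma chunks_lengths:
  "length w = s * b \<Longrightarrow> length (chunks b s w) = s \<and> (\<forall>u\<in>set (chunks b s w). length u = b)"
proof (induction s arbitrary: w)
  case (Suc s)
  show ?case using Suc.IH[of "drop b w"] Suc.prems by simp
qed simp

lemma length_concat_const: "\<forall>w\<in>set ws. length w = b \<Longrightarrow> length (concat ws) = length ws * b"
  by (induction ws) auto

lemma set_seq_pmf: "set_pmf (seq_pmf ps) = {xs. list_all2 (\<lambda>x p. x \<in> set_pmf p) xs ps}"
  by (induction ps) (auto simp: list_all2_Cons2)

text \<open>Running \<open>s\<close> independent two-stage experiments is the same as performing all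
  first stages and then all second stages. In the induction, the second stage of the first
  experiment commutes with the independent first stages of the others.\<close>

lemma replicate_pmf_bind:
  "replicate_pmf s (bind_pmf W f) = bind_pmf (replicate_pmf s W) (\<lambda>ws. seq_pmf (map f ws))"
proof (induction s)
  case 0
  then show ?case by (simp add: bind_return_pmf)
next
  case (Suc s)
  have "replicate_pmf (Suc s) (bind_pmf W f) =
      bind_pmf W (\<lambda>w. bind_pmf (f w) (\<lambda>x. bind_pmf (replicate_pmf s W)
        (\<lambda>ws. map_pmf ((#) x) (seq_pmf (map f ws)))))"
    by (simp add: Suc bind_assoc_pmf map_pmf_def)
  also have "\<dots> = bind_pmf W (\<lambda>w. bind_pmf (replicate_pmf s W) (\<lambda>ws. bind_pmf (f w)
        (\<lambda>x. map_pmf ((#) x) (seq_pmf (map f ws)))))"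
    by (subst bind_commute_pmf) (rule refl)
  finally show ?case by (simp add: bind_assoc_pmf bind_return_pmf)
qed

lemma replicate_pmf_map: "replicate_pmf s (map_pmf f W) = map_pmf (map f) (replicate_pmf s W)"
  by (induction s) (simp_all add: map_pmf_def bind_assoc_pmf bind_return_pmf)

section \<open>Simulating several copies in one memory\<close>

definition alg_state :: "'i stream_alg \<Rightarrow> 'i list \<Rightarrow> bool list pmf" where
  "alg_state A xs = foldl (\<lambda>W x. bind_pmf W (alg_step A x)) (alg_init A) xs"

lemma alg_output_eq_map_alg_state: "alg_output A xs = map_pmf (alg_out A) (alg_state A xs)"
  by (simp add: alg_output_def alg_state_def)

lemma set_alg_state:
  assumes "streaming_algorithm X A" "set xs \<subseteq> X"
  shows "set_pmf (alg_state A xs) \<subseteq> {w. length w = alg_bits A}"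
  using assms(2)
proof (induction xs rule: rev_induct)
  case Nil
  then show ?case using assms(1) by (simp add: alg_state_def streaming_algorithm_def)
next
  case (snoc x xs)
  then show ?case using assms(1) by (fastforce simp: alg_state_def streaming_algorithm_def)
qed

lemma finite_set_alg_output:
  assumes "streaming_algorithm X A" "set xs \<subseteq> X"
  shows "finite (set_pmf (alg_output A xs))"
proof -
  have "finite {w :: bool list. length w = alg_bits A}"
    using finite_lists_length_eq[of "UNIV :: bool set"] by simp
  then show ?thesis
    using finite_subset[OF set_alg_state[OF assms]] by (simp add: alg_output_eq_map_alg_state)
qed

text \<open>The memories of the copies are stored side by side as blocks of equal length, so no
  separators are needed. The result is again a streaming algorithm, which permits nesting: means
  inside, a median outside.\<close>

definition parallel :: "nat \<Rightarrow> (real list \<Rightarrow> real) \<Rightarrow> 'i stream_alg \<Rightarrow> 'i stream_alg" where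
  "parallel s g A = \<lparr>
     alg_bits = s * alg_bits A,
     alg_init = map_pmf concat (replicate_pmf s (alg_init A)),
     alg_step = (\<lambda>x w. map_pmf concat (seq_pmf (map (alg_step A x) (chunks (alg_bits A) s w)))),
     alg_out = (\<lambda>w. g (map (alg_out A) (chunks (alg_bits A) s w)))\<rparr>"

lemma alg_bits_parallel [simp]: "alg_bits (parallel s g A) = s * alg_bits A"
  by (simp add: parallel_def)

lemma streaming_algorithm_parallel:
  assumes A: "streaming_algorithm X A"
  shows "streaming_algorithm X (parallel s g A)"
  unfolding streaming_algorithm_def
proof (intro conjI ballI allI impI)
  show "set_pmf (alg_init (parallel s g A)) \<subseteq> {w. length w = alg_bits (parallel s g A)}"
    using A by (auto simp: parallel_def streaming_algorithm_def set_replicate_pmf subset_iff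
        intro!: length_concat_const)
next
  fix x and w :: "bool list" assume x: "x \<in> X" and w: "length w = alg_bits (parallel s g A)"
  have c: "length (chunks (alg_bits A) s w) = s" "\<forall>u\<in>set (chunks (alg_bits A) s w). length u = alg_bits A"
    using chunks_lengths[of w s "alg_bits A"] w by (auto simp: parallel_def)
  have "length ws = s \<and> (\<forall>u\<in>set ws. length u = alg_bits A)"
    if "ws \<in> set_pmf (seq_pmf (map (alg_step A x) (chunks (alg_bits A) s w)))" for ws
  proof -
    have l: "list_all2 (\<lambda>u p. u \<in> set_pmf p) ws (map (alg_step A x) (chunks (alg_bits A) s w))"
      using that by (simp add: set_seq_pmf)
    then have "length ws = s" using c by (auto dest: list_all2_lengthD)
    moreover have "length (ws ! i) = alg_bits A" if "i < length ws" for i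
    proof -
      have "ws ! i \<in> set_pmf (alg_step A x (chunks (alg_bits A) s w ! i))"
        using list_all2_nthD[OF l that] that c \<open>length ws = s\<close> by simp
      moreover have "length (chunks (alg_bits A) s w ! i) = alg_bits A"
        using c that \<open>length ws = s\<close> by simp
      ultimately show ?thesis using A x unfolding streaming_algorithm_def by blast
    qed
    ultimately show ?thesis by (auto simp: in_set_conv_nth)
  qed
  then show "set_pmf (alg_step (parallel s g A) x w) \<subseteq> {w'. length w' = alg_bits (parallel s g A)}"
    using length_concat_const[of _ "alg_bits A"] by (fastforce simp: parallel_def)
qed

text \<open>The copies stay independent and identically distributed after every item. Every
  reachable memory of a copy has exactly \<open>alg_bits A\<close> bits, so \<open>chunks\<close>
  recovers the blocks from their concatenation, and \<open>replicate_pmf_bind\<close> performs one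
  step of all copies.\<close>

lemma alg_state_parallel:
  assumes A: "streaming_algorithm X A" and "set xs \<subseteq> X"
  shows "alg_state (parallel s g A) xs = map_pmf concat (replicate_pmf s (alg_state A xs))"
  using assms(2)
proof (induction xs rule: rev_induct)
  case Nil
  then show ?case by (simp add: alg_state_def parallel_def)
next
  case (snoc x xs)
  have S: "alg_state B (xs @ [x]) = bind_pmf (alg_state B xs) (alg_step B x)" for B :: "'a stream_alg"
    by (simp add: alg_state_def)
  have "alg_state (parallel s g A) (xs @ [x]) =
      bind_pmf (replicate_pmf s (alg_state A xs)) (\<lambda>ws. alg_step (parallel s g A) x (concat ws))"
    using snoc by (simp add: S bind_map_pmf)
  also have "\<dots> = bind_pmf (replicate_pmf s (alg_state A xs))
      (\<lambda>ws. map_pmf concat (seq_pmf (map (alg_step A x) ws)))"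
  proof (rule bind_pmf_cong[OF refl])
    fix ws assume "ws \<in> set_pmf (replicate_pmf s (alg_state A xs))"
    then have "length ws = s" "\<forall>w\<in>set ws. length w = alg_bits A"
      using set_alg_state[OF A, of xs] snoc.prems by (auto simp: set_replicate_pmf)
    then show "alg_step (parallel s g A) x (concat ws) = map_pmf concat (seq_pmf (map (alg_step A x) ws))"
      by (simp add: parallel_def chunks_concat)
  qed
  also have "\<dots> = map_pmf concat (replicate_pmf s (alg_state A (xs @ [x])))"
    by (simp add: S replicate_pmf_bind map_bind_pmf)
  finally show ?case .
qed

lemma alg_output_parallel:
  assumes A: "streaming_algorithm X A" and xs: "set xs \<subseteq> X"
  shows "alg_output (parallel s g A) xs = map_pmf g (replicate_pmf s (alg_output A xs))"
proof -
  have "alg_output (parallel s g A) xs =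
      map_pmf (\<lambda>ws. alg_out (parallel s g A) (concat ws)) (replicate_pmf s (alg_state A xs))"
    by (simp add: alg_output_eq_map_alg_state alg_state_parallel[OF assms] map_pmf_comp)
  also have "\<dots> = map_pmf (\<lambda>ws. g (map (alg_out A) ws)) (replicate_pmf s (alg_state A xs))"
  proof (rule map_pmf_cong[OF refl])
    fix ws assume "ws \<in> set_pmf (replicate_pmf s (alg_state A xs))"
    then have "length ws = s" "\<forall>w\<in>set ws. length w = alg_bits A"
      using set_alg_state[OF assms] by (auto simp: set_replicate_pmf)
    then show "alg_out (parallel s g A) (concat ws) = g (map (alg_out A) ws)"
      by (simp add: parallel_def chunks_concat)
  qed
  also have "\<dots> = map_pmf g (replicate_pmf s (alg_output A xs))"
    by (simp add: alg_output_eq_map_alg_state replicate_pmf_map map_pmf_comp)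
  finally show ?thesis .
qed

section \<open>Median of means\<close>

lemma finite_set_replicate_pmf: "finite (set_pmf p) \<Longrightarrow> finite (set_pmf (replicate_pmf s p))"
  by (induction s) auto

text \<open>Conditioning on the first sample; finite support takes care of all integrability
  conditions.\<close>

lemma expectation_replicate_pmf_Suc:
  fixes f :: "'a list \<Rightarrow> real"
  assumes p: "finite (set_pmf p)"
  shows "measure_pmf.expectation (replicate_pmf (Suc s) p) f =
    measure_pmf.expectation p (\<lambda>x. measure_pmf.expectation (replicate_pmf s p) (\<lambda>xs. f (x # xs)))"
proof -
  have "replicate_pmf (Suc s) p = bind_pmf p (\<lambda>x. map_pmf ((#) x) (replicate_pmf s p))"
    by (simp add: map_pmf_def)
  then have "measure_pmf.expectation (replicate_pmf (Suc s) p) f =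
     (\<Sum>x\<in>set_pmf p. pmf p x *\<^sub>R measure_pmf.expectation (map_pmf ((#) x) (replicate_pmf s p)) f)"
    using p by (simp add: pmf_expectation_bind[OF p] finite_set_replicate_pmf)
  also have "\<dots> = measure_pmf.expectation p (\<lambda>x. measure_pmf.expectation (map_pmf ((#) x) (replicate_pmf s p)) f)"
    by (subst integral_measure_pmf[OF p]) auto
  finally show ?thesis by simp
qed

text \<open>Both moments are proved in one induction, since the cross term in the expansion of the
  square vanishes by the claim about the first moment.\<close>

lemma moments_sum_list_replicate_pmf:
  fixes p :: "real pmf"
  assumes p: "finite (set_pmf p)" and a: "measure_pmf.expectation p (\<lambda>x. x) = a"
  shows "measure_pmf.expectation (replicate_pmf s p) (\<lambda>xs. sum_list xs - s * a) = 0 \<and>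
    measure_pmf.expectation (replicate_pmf s p) (\<lambda>xs. (sum_list xs - s * a)\<^sup>2) =
      s * measure_pmf.expectation p (\<lambda>x. (x - a)\<^sup>2)"
proof (induction s)
  case 0
  then show ?case by simp
next
  case (Suc s)
  let ?E = "measure_pmf.expectation (replicate_pmf s p)" and ?V = "measure_pmf.expectation p (\<lambda>x. (x - a)\<^sup>2)"
  have i: "integrable (measure_pmf p) f" for f :: "real \<Rightarrow> real"
    by (rule integrable_measure_pmf_finite[OF p])
  have j: "integrable (measure_pmf (replicate_pmf s p)) f" for f :: "real list \<Rightarrow> real"
    by (rule integrable_measure_pmf_finite[OF finite_set_replicate_pmf[OF p]])
  define D where "D xs = sum_list xs - s * a" for xs
  have IH: "?E D = 0" "?E (\<lambda>xs. (D xs)\<^sup>2) = s * ?V"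
    using Suc unfolding D_def by blast+
  have 1: "?E (\<lambda>xs. sum_list (x # xs) - Suc s * a) = x - a" for x
  proof -
    have "(\<lambda>xs. sum_list (x # xs) - Suc s * a) = (\<lambda>xs. (x - a) + D xs)"
      by (simp add: D_def algebra_simps)
    then show ?thesis using IH j by simp
  qed
  have 2: "?E (\<lambda>xs. (sum_list (x # xs) - Suc s * a)\<^sup>2) = (x - a)\<^sup>2 + s * ?V" for x
  proof -
    have "(\<lambda>xs. (sum_list (x # xs) - Suc s * a)\<^sup>2) = (\<lambda>xs. (x - a)\<^sup>2 + 2 * (x - a) * D xs + (D xs)\<^sup>2)"
      by (simp add: D_def algebra_simps power2_eq_square)
    then show ?thesis using IH j by simp
  qed
  show ?case unfolding expectation_replicate_pmf_Suc[OF p] 1 2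
    using i a by (simp add: algebra_simps)
qed

definition mean :: "real list \<Rightarrow> real" where
  "mean xs = sum_list xs / length xs"

text \<open>The case \<open>t = 0\<close> is needed for \<open>v = 0\<close>, where the target interval is a single point.\<close>

lemma prob_deviation_le_quarter:
  fixes f :: "'a \<Rightarrow> real"
  assumes q: "finite (set_pmf q)" and t: "0 \<le> t"
    and E: "measure_pmf.expectation q (\<lambda>x. (f x)\<^sup>2) \<le> t\<^sup>2 / 4"
  shows "measure_pmf.prob q {x. t < \<bar>f x\<bar>} \<le> 1 / 4"
proof (cases "t = 0")
  case True
  have i: "integrable (measure_pmf q) (\<lambda>x. (f x)\<^sup>2)" by (rule integrable_measure_pmf_finite[OF q])
  have "measure_pmf.expectation q (\<lambda>x. (f x)\<^sup>2) = 0"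
    using E True by (intro antisym integral_nonneg) auto
  then have "AE x in measure_pmf q. (f x)\<^sup>2 = 0"
    using integral_nonneg_eq_0_iff_AE[OF i] by simp
  then have "measure_pmf.prob q {x. t < \<bar>f x\<bar>} = 0"
    using True by (subst measure_pmf_zero_iff) (auto simp: AE_measure_pmf_iff)
  then show ?thesis by simp
next
  case False
  then have "0 < t" using t by simp
  have "measure_pmf.prob q {x. t < \<bar>f x\<bar>} = measure_pmf.expectation q (indicator {x. t < \<bar>f x\<bar>})"
    by simp
  also have "\<dots> \<le> measure_pmf.expectation q (\<lambda>x. (f x)\<^sup>2 / t\<^sup>2)"
  proof (intro integral_mono integrable_measure_pmf_finite[OF q])
    fix x
    show "indicator {x. t < \<bar>f x\<bar>} x \<le> (f x)\<^sup>2 / t\<^sup>2"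
      using \<open>0 < t\<close> power_mono[of t "\<bar>f x\<bar>" 2] by (auto simp: indicator_def field_simps)
  qed
  also have "\<dots> \<le> 1 / 4" using E \<open>0 < t\<close> by (simp add: field_simps)
  finally show ?thesis .
qed

text \<open>Averaging \<open>s\<close> independent samples divides the variance by \<open>s\<close>,
  after which Chebyshev's inequality applies.\<close>

lemma prob_mean_deviation_le_quarter:
  fixes p :: "real pmf"
  assumes p: "finite (set_pmf p)" and a: "measure_pmf.expectation p (\<lambda>x. x) = a"
    and V: "measure_pmf.expectation p (\<lambda>x. (x - a)\<^sup>2) \<le> s * t\<^sup>2 / 4" and s: "0 < s" and t: "0 \<le> t"
  shows "measure_pmf.prob (map_pmf mean (replicate_pmf s p)) {x. t < \<bar>x - a\<bar>} \<le> 1 / 4"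
proof (rule prob_deviation_le_quarter[OF _ t])
  show "finite (set_pmf (map_pmf mean (replicate_pmf s p)))"
    using finite_set_replicate_pmf[OF p] by simp
  have "measure_pmf.expectation (map_pmf mean (replicate_pmf s p)) (\<lambda>x. (x - a)\<^sup>2) =
     measure_pmf.expectation (replicate_pmf s p) (\<lambda>xs. (mean xs - a)\<^sup>2)"
    by simp
  also have "\<dots> = measure_pmf.expectation (replicate_pmf s p) (\<lambda>xs. (sum_list xs - s * a)\<^sup>2 / (real s)\<^sup>2)"
  proof (rule integral_cong_AE)
    \<comment> \<open>The two integrands need only agree on the support, where every list has length
      \<open>s\<close>.\<close>
    show "AE xs in measure_pmf (replicate_pmf s p). (mean xs - a)\<^sup>2 = (sum_list xs - real s * a)\<^sup>2 / (real s)\<^sup>2"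
      using s by (auto simp: AE_measure_pmf_iff set_replicate_pmf mean_def field_simps simp flip: power_divide)
  qed auto
  also have "\<dots> = measure_pmf.expectation p (\<lambda>x. (x - a)\<^sup>2) / s"
    using moments_sum_list_replicate_pmf[OF p a, of s] by (simp add: power2_eq_square)
  also have "\<dots> \<le> t\<^sup>2 / 4" using V s by (simp add: field_simps)
  finally show "measure_pmf.expectation (map_pmf mean (replicate_pmf s p)) (\<lambda>x. (x - a)\<^sup>2) \<le> t\<^sup>2 / 4" .
qed

text \<open>For even lengths this is the upper of the two middle entries.\<close>

definition median :: "real list \<Rightarrow> real" where
  "median xs = sort xs ! (length xs div 2)"

text \<open>If the middle entry of the sorted list were below the interval, so would be all entries
  before it; if above, all entries after it. Together with the middle entry these make up at least
  half of the list, against the strict bound assumed.\<close>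

lemma median_in_interval:
  assumes "2 * length (filter (\<lambda>x. x \<notin> {l..u}) xs) < length xs"
  shows "median xs \<in> {l..u}"
proof -
  define ys where "ys = sort xs"
  have len: "length ys = length xs" and sorted: "sorted ys" by (simp_all add: ys_def)
  let ?m = "length xs div 2" and ?B = "{i. i < length ys \<and> ys ! i \<notin> {l..u}}"
  have m: "?m < length ys" using assms len by linarith
  have "length (filter (\<lambda>x. x \<notin> {l..u}) ys) = length (filter (\<lambda>x. x \<notin> {l..u}) xs)"
    by (metis mset_filter mset_sort size_mset ys_def)
  then have card: "2 * card ?B < length xs"
    using assms by (simp add: length_filter_conv_card)
  have "l \<le> ys ! ?m"
  proof (rule ccontr)
    assume "\<not> l \<le> ys ! ?m"
    then have "{..?m} \<subseteq> ?B"
      using m sorted_nth_mono[OF sorted _ m] by fastforce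
    then have "card {..?m} \<le> card ?B" by (intro card_mono) auto
    then show False using card by simp
  qed
  moreover have "ys ! ?m \<le> u"
  proof (rule ccontr)
    assume "\<not> ys ! ?m \<le> u"
    then have "{?m..<length ys} \<subseteq> ?B"
      using m sorted_nth_mono[OF sorted, of ?m] by fastforce
    then have "card {?m..<length ys} \<le> card ?B" by (intro card_mono) auto
    then show False using card len by simp
  qed
  ultimately show ?thesis by (simp add: median_def ys_def)
qed

text \<open>Markov's inequality for \<open>4\<close> to the number of bad samples.\<close>

lemma prob_half_bad_le:
  assumes p: "finite (set_pmf p)" and B: "measure_pmf.prob p B \<le> 1 / 4"
  shows "measure_pmf.prob (replicate_pmf s p) {xs. s \<le> 2 * length (filter (\<lambda>x. x \<in> B) xs)} \<le> (7 / 8) ^ s"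
proof -
  let ?c = "\<lambda>xs. length (filter (\<lambda>x. x \<in> B) xs)"
  have mgf: "measure_pmf.expectation (replicate_pmf s p) (\<lambda>xs. 4 ^ ?c xs) = (1 + 3 * measure_pmf.prob p B) ^ s"
  proof (induction s)
    case 0
    then show ?case by simp
  next
    case (Suc s)
    have "4 ^ ?c (x # xs) = (1 + 3 * indicator B x) * (4 :: real) ^ ?c xs" for x xs
      by simp
    then have "measure_pmf.expectation (replicate_pmf (Suc s) p) (\<lambda>xs. 4 ^ ?c xs) =
       measure_pmf.expectation p (\<lambda>x. (1 + 3 * indicator B x) * (1 + 3 * measure_pmf.prob p B) ^ s)"
      unfolding expectation_replicate_pmf_Suc[OF p] using Suc by simp
    also have "\<dots> = (1 + 3 * measure_pmf.prob p B) ^ Suc s"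
      by (simp add: integrable_measure_pmf_finite[OF p])
    finally show ?case .
  qed
  have "measure_pmf.prob (replicate_pmf s p) {xs. s \<le> 2 * ?c xs} =
      measure_pmf.expectation (replicate_pmf s p) (indicator {xs. s \<le> 2 * ?c xs})"
    by simp
  also have "\<dots> \<le> measure_pmf.expectation (replicate_pmf s p) (\<lambda>xs. 4 ^ ?c xs / 2 ^ s)"
  proof (intro integral_mono integrable_measure_pmf_finite[OF finite_set_replicate_pmf[OF p]])
    fix xs
    have "(2::real) ^ s \<le> 4 ^ ?c xs" if "s \<le> 2 * ?c xs"
      using power_increasing[OF that, of "2::real"] by (simp add: power_mult)
    then show "indicator {xs. s \<le> 2 * ?c xs} xs \<le> 4 ^ ?c xs / (2::real) ^ s"
      by (auto simp: indicator_def)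
  qed
  also have "\<dots> = ((1 + 3 * measure_pmf.prob p B) / 2) ^ s"
    by (simp add: mgf power_divide)
  \<comment> \<open>With \<open>prob p B\<close> at most 1/4, the base is at most (1 + 3/4) / 2 =
    7/8.\<close>
  also have "\<dots> \<le> (7 / 8) ^ s"
    using B by (intro power_mono) auto
  finally show ?thesis .
qed

text \<open>The median can miss the interval only if at least half of the samples do.\<close>

lemma prob_median_ge:
  fixes p :: "real pmf"
  assumes p: "finite (set_pmf p)" and B: "measure_pmf.prob p (- {l..u}) \<le> 1 / 4"
  shows "1 - (7 / 8) ^ s \<le> measure_pmf.prob (map_pmf median (replicate_pmf s p)) {l..u}"
proof -
  let ?bad = "{xs. s \<le> 2 * length (filter (\<lambda>x. x \<in> - {l..u}) xs)}"
  have "1 - (7 / 8) ^ s \<le> 1 - measure_pmf.prob (replicate_pmf s p) ?bad"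
    using prob_half_bad_le[OF p B, of s] by simp
  also have "\<dots> = measure_pmf.prob (replicate_pmf s p) (- ?bad)"
    using measure_pmf.prob_compl[of ?bad "replicate_pmf s p"] by (simp add: Compl_eq_Diff_UNIV)
  also have "\<dots> \<le> measure_pmf.prob (replicate_pmf s p) (median -` {l..u})"
  proof (rule measure_pmf.finite_measure_mono_AE)
    show "AE xs in measure_pmf (replicate_pmf s p). xs \<in> - ?bad \<longrightarrow> xs \<in> median -` {l..u}"
    proof (rule AE_pmfI, rule impI)
      fix xs assume "xs \<in> set_pmf (replicate_pmf s p)" "xs \<in> - ?bad"
      then have "2 * length (filter (\<lambda>x. x \<notin> {l..u}) xs) < length xs"
        by (simp add: set_replicate_pmf not_le)
      then show "xs \<in> median -` {l..u}" using median_in_interval by blast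
    qed
  qed simp
  finally show ?thesis by simp
qed

section \<open>Accuracy and space\<close>

text \<open>The size of \<open>s1\<close> brings the variance of each mean down to a quarter of the
  squared tolerance \<open>\<epsilon> * sqnorm n k (u xs)\<close>, so each mean fails with
  probability at most 1/4. The median of \<open>s2\<close> means then reduces the failure
  probability exponentially.\<close>

lemma prob_median_of_means_ge:
  assumes R: "random_signs M n k h" and A: "streaming_algorithm (cube n k) A"
    and Y: "maintains_instance M S (\<lambda>xs. sketch n k h (u xs)) A"
    and xs: "xs \<in> S" "set xs \<subseteq> cube n k" and \<epsilon>: "0 < \<epsilon>"
    and s1: "0 < s1" "4 * 3 ^ k / \<epsilon>\<^sup>2 \<le> real s1"
  shows "1 - (7 / 8) ^ s2 \<le> measure_pmf.prob (alg_output (parallel s2 median (parallel s1 mean A)) xs)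
    {(1 - \<epsilon>) * sqnorm n k (u xs) .. (1 + \<epsilon>) * sqnorm n k (u xs)}"
proof -
  interpret prob_space M using R by (simp add: random_signs_def)
  let ?Y = "sketch n k h (u xs)"
  define F where "F = sqnorm n k (u xs)"
  define p where "p = alg_output A xs"
  have F: "0 \<le> F" by (simp add: F_def sqnorm_def sum_nonneg)
  have p: "finite (set_pmf p)" unfolding p_def by (rule finite_set_alg_output[OF A xs(2)])
  note i1 = expectation_sketch(2)[OF R, of "u xs"] and i2 = expectation_sketch_square_le(2)[OF R, of "u xs"]
  have E: "measure_pmf.expectation p f = (\<integral>\<omega>. f (?Y \<omega>) \<partial>M)" for f :: "real \<Rightarrow> real"
  proof (rule expectation_pmf_eq_integral)
    show "measure_pmf.prob p B = prob {\<omega> \<in> space M. ?Y \<omega> \<in> B}" for B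
      using Y xs(1) by (simp add: maintains_instance_def p_def)
  qed (use i1 finite_range_sketch[OF R] prob_space_axioms in auto)
  have a: "measure_pmf.expectation p (\<lambda>x. x) = F"
    by (simp add: E expectation_sketch(1)[OF R] F_def)
  have "measure_pmf.expectation p (\<lambda>x. (x - F)\<^sup>2) = (\<integral>\<omega>. (?Y \<omega>)\<^sup>2 - 2 * F * ?Y \<omega> + F\<^sup>2 \<partial>M)"
    unfolding E by (intro Bochner_Integration.integral_cong refl) (simp add: power2_eq_square algebra_simps)
  also have "\<dots> = (\<integral>\<omega>. (?Y \<omega>)\<^sup>2 \<partial>M) - 2 * F * (\<integral>\<omega>. ?Y \<omega> \<partial>M) + F\<^sup>2"
    using i1 i2 by (simp add: prob_space)
  \<comment> \<open>The mean is \<open>F\<close>, so the middle terms combine to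
    \<open>- F\<^sup>2\<close>, which is dropped.\<close>
  also have "\<dots> \<le> 3 ^ k * F\<^sup>2"
  proof -
    have "2 * F * (\<integral>\<omega>. ?Y \<omega> \<partial>M) = 2 * F\<^sup>2"
      by (simp add: expectation_sketch(1)[OF R] F_def power2_eq_square)
    then show ?thesis
      using expectation_sketch_square_le(1)[OF R, of "u xs", folded F_def] zero_le_power2[of F]
      by linarith
  qed
  also have "\<dots> = (4 * 3 ^ k / \<epsilon>\<^sup>2) * (\<epsilon> * F)\<^sup>2 / 4"
    using \<epsilon> by (simp add: power_mult_distrib)
  also have "\<dots> \<le> s1 * (\<epsilon> * F)\<^sup>2 / 4"
    using s1 by (intro divide_right_mono mult_right_mono) auto
  finally have "measure_pmf.prob (map_pmf mean (replicate_pmf s1 p)) {x. \<epsilon> * F < \<bar>x - F\<bar>} \<le> 1 / 4"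
    using \<epsilon> F s1 by (intro prob_mean_deviation_le_quarter[OF p a]) auto
  moreover have "{x. \<epsilon> * F < \<bar>x - F\<bar>} = - {(1 - \<epsilon>) * F .. (1 + \<epsilon>) * F}"
    by (auto simp: algebra_simps abs_if)
  ultimately have "1 - (7 / 8) ^ s2 \<le> measure_pmf.prob (map_pmf median (replicate_pmf s2
      (map_pmf mean (replicate_pmf s1 p)))) {(1 - \<epsilon>) * F .. (1 + \<epsilon>) * F}"
    using finite_set_replicate_pmf[OF p] by (intro prob_median_ge) auto
  then show ?thesis
    unfolding alg_output_parallel[OF streaming_algorithm_parallel[OF A] xs(2)]
      alg_output_parallel[OF A xs(2)] F_def p_def .
qed

text \<open>On a principal filter, big-O involves no limit: it is one inequality with a common
  constant on the whole parameter set.\<close>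

lemma param_bigo_iff:
  "param_bigo f g \<longleftrightarrow> (\<forall>\<delta>\<^sub>0\<in>{0<..<1}. \<exists>c>0. \<forall>n m k \<epsilon> \<delta>.
     0 < n \<and> 0 < m \<and> 0 < k \<and> 0 < \<epsilon> \<and> \<epsilon> < 1 \<and> 0 < \<delta> \<and> \<delta> \<le> \<delta>\<^sub>0 \<longrightarrow>
       \<bar>f (n, m, k, \<epsilon>, \<delta>)\<bar> \<le> c * \<bar>g (n, m, k, \<epsilon>, \<delta>)\<bar>)"
  by (simp add: param_bigo_def bigo_def eventually_principal split_paired_all imp_conjL)

theorem theorem4p2:
  fixes v :: "nat \<Rightarrow> nat \<Rightarrow> nat \<Rightarrow> (nat \<Rightarrow> nat) list \<Rightarrow> (nat \<Rightarrow> nat) \<Rightarrow> real"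
    and M :: "nat \<Rightarrow> nat \<Rightarrow> nat \<Rightarrow> 'w measure"
    and h :: "nat \<Rightarrow> nat \<Rightarrow> nat \<Rightarrow> nat \<Rightarrow> 'w \<Rightarrow> nat \<Rightarrow> real"
    and \<mu> :: "nat \<Rightarrow> nat \<Rightarrow> nat \<Rightarrow> real \<Rightarrow> real \<Rightarrow> real"
  assumes "\<And>n m k. 0 < n \<Longrightarrow> 0 < m \<Longrightarrow> 0 < k \<Longrightarrow> random_signs (M n m k) n k (h n m k)"
    and "\<exists>A. (\<forall>n m k \<epsilon> \<delta>. 0 < n \<longrightarrow> 0 < m \<longrightarrow> 0 < k \<longrightarrow> 0 < \<epsilon> \<longrightarrow> \<epsilon> < 1 \<longrightarrow> 0 < \<delta> \<longrightarrow> \<delta> < 1 \<longrightarrow>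
               streaming_algorithm (cube n k) (A n m k \<epsilon> \<delta>) \<and>
               maintains_instance (M n m k) (streams_of n m k)
                 (\<lambda>xs. sketch n k (h n m k) (v n m k xs)) (A n m k \<epsilon> \<delta>)) \<and>
             param_bigo (\<lambda>(n, m, k, \<epsilon>, \<delta>). real (alg_bits (A n m k \<epsilon> \<delta>)))
               (\<lambda>(n, m, k, \<epsilon>, \<delta>). \<mu> n m k \<epsilon> \<delta>)"
  shows "\<exists>\<Lambda>. (\<forall>n m k \<epsilon> \<delta>. 0 < n \<longrightarrow> 0 < m \<longrightarrow> 0 < k \<longrightarrow> 0 < \<epsilon> \<longrightarrow> \<epsilon> < 1 \<longrightarrow> 0 < \<delta> \<longrightarrow> \<delta> < 1 \<longrightarrow>
               streaming_algorithm (cube n k) (\<Lambda> n m k \<epsilon> \<delta>) \<and>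
               (\<forall>xs\<in>streams_of n m k.
                  measure_pmf.prob (alg_output (\<Lambda> n m k \<epsilon> \<delta>) xs)
                    {(1 - \<epsilon>) * sqnorm n k (v n m k xs) .. (1 + \<epsilon>) * sqnorm n k (v n m k xs)}
                  \<ge> 1 - \<delta>)) \<and>
             param_bigo (\<lambda>(n, m, k, \<epsilon>, \<delta>). real (alg_bits (\<Lambda> n m k \<epsilon> \<delta>)))
               (\<lambda>(n, m, k, \<epsilon>, \<delta>). 3 ^ k * (1 / \<epsilon>\<^sup>2) * ln (1 / \<delta>) * \<mu> n m k \<epsilon> \<delta>)"
proof -
  obtain A where A_all: "\<forall>n m k \<epsilon> \<delta>. 0 < n \<longrightarrow> 0 < m \<longrightarrow> 0 < k \<longrightarrow> 0 < \<epsilon> \<longrightarrow> \<epsilon> < 1 \<longrightarrow> 0 < \<delta> \<longrightarrow> \<delta> < 1 \<longrightarrow>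
        streaming_algorithm (cube n k) (A n m k \<epsilon> \<delta>) \<and>
        maintains_instance (M n m k) (streams_of n m k)
          (\<lambda>xs. sketch n k (h n m k) (v n m k xs)) (A n m k \<epsilon> \<delta>)"
    and bits: "param_bigo (\<lambda>(n, m, k, \<epsilon>, \<delta>). real (alg_bits (A n m k \<epsilon> \<delta>))) (\<lambda>(n, m, k, \<epsilon>, \<delta>). \<mu> n m k \<epsilon> \<delta>)"
    using assms(2) by (elim exE conjE)
  note A = A_all[rule_format]
  \<comment> \<open>The decay rate of the failure bound: \<open>(7 / 8) ^ s\<close> is at most
    \<delta> as soon as \<open>s\<close> is at least \<open>ln (1 / \<delta>) / L\<close>.\<close>
  define L where "L = ln (8 / 7 :: real)"
  have L: "0 < L" by (simp add: L_def)
  define s1 :: "nat \<Rightarrow> real \<Rightarrow> nat" where "s1 k \<epsilon> = nat \<lceil>4 * 3 ^ k / \<epsilon>\<^sup>2\<rceil>" for k \<epsilon>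
  define s2 :: "real \<Rightarrow> nat" where "s2 \<delta> = nat \<lceil>ln (1 / \<delta>) / L\<rceil>" for \<delta>
  define \<Lambda> where "\<Lambda> n m k \<epsilon> \<delta> = parallel (s2 \<delta>) median (parallel (s1 k \<epsilon>) mean (A n m k \<epsilon> \<delta>))"
    for n m k \<epsilon> \<delta>
  have of_nat_ceiling_le_add_one: "real (nat \<lceil>x\<rceil>) \<le> x + 1" if "0 \<le> x" for x :: real
    using that by linarith
  have s1: "0 < s1 k \<epsilon>" "4 * 3 ^ k / \<epsilon>\<^sup>2 \<le> s1 k \<epsilon>" if "0 < \<epsilon>" for k \<epsilon>
    using that by (simp_all add: s1_def real_nat_ceiling_ge)
  \<comment> \<open>The 1 lost in rounding up is absorbed because
    \<open>3 ^ k / \<epsilon>\<^sup>2\<close> is at least 1; hence 5 in place of 4.\<close>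
  have s1': "real (s1 k \<epsilon>) \<le> 5 * (3 ^ k * (1 / \<epsilon>\<^sup>2))" if "0 < \<epsilon>" "\<epsilon> < 1" for k \<epsilon>
  proof -
    have "\<epsilon>\<^sup>2 \<le> 1" using that by (simp add: power_le_one)
    also have "1 \<le> (3::real) ^ k" by simp
    finally have "1 \<le> 3 ^ k * (1 / \<epsilon>\<^sup>2)" using that by (simp add: field_simps)
    moreover have "real (s1 k \<epsilon>) \<le> 4 * 3 ^ k / \<epsilon>\<^sup>2 + 1"
      unfolding s1_def by (rule of_nat_ceiling_le_add_one) simp
    ultimately show ?thesis by simp
  qed
  have s2: "(7 / 8) ^ s2 \<delta> \<le> \<delta>" if "0 < \<delta>" "\<delta> < 1" for \<delta>
  proof -
    have "ln (1 / \<delta>) / L \<le> s2 \<delta>" by (simp add: s2_def real_nat_ceiling_ge)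
    then have "ln (1 / \<delta>) \<le> ln ((8 / 7) ^ s2 \<delta>)" using L by (subst ln_realpow) (simp_all add: L_def pos_divide_le_eq)
    then have "1 / \<delta> \<le> (8 / 7) ^ s2 \<delta>" using that by (subst (asm) ln_le_cancel_iff) auto
    then have "1 / (8 / 7) ^ s2 \<delta> \<le> \<delta>" using that by (simp add: field_simps)
    then show ?thesis by (simp flip: power_one_over)
  qed
  \<comment> \<open>Here \<delta> must stay away from 1: the 1 lost in rounding up is absorbed by
    \<open>ln (1 / \<delta>) / ln (1 / \<delta>\<^sub>0)\<close>, which is at least 1.\<close>
  have s2': "real (s2 \<delta>) \<le> (1 / L + 1 / ln (1 / \<delta>\<^sub>0)) * ln (1 / \<delta>)"
    if "0 < \<delta>" "\<delta> \<le> \<delta>\<^sub>0" "\<delta>\<^sub>0 < 1" for \<delta> \<delta>\<^sub>0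
  proof -
    have "0 < ln (1 / \<delta>\<^sub>0)" "ln (1 / \<delta>\<^sub>0) \<le> ln (1 / \<delta>)" using that by (auto simp: field_simps ln_div)
    then have "1 \<le> ln (1 / \<delta>) / ln (1 / \<delta>\<^sub>0)" "0 \<le> ln (1 / \<delta>) / L" using L by auto
    moreover from this(2) have "real (s2 \<delta>) \<le> ln (1 / \<delta>) / L + 1"
      unfolding s2_def by (rule of_nat_ceiling_le_add_one)
    ultimately show ?thesis by (simp add: distrib_right)
  qed
  have accurate: "streaming_algorithm (cube n k) (\<Lambda> n m k \<epsilon> \<delta>) \<and>
      (\<forall>xs\<in>streams_of n m k. measure_pmf.prob (alg_output (\<Lambda> n m k \<epsilon> \<delta>) xs)
        {(1 - \<epsilon>) * sqnorm n k (v n m k xs) .. (1 + \<epsilon>) * sqnorm n k (v n m k xs)} \<ge> 1 - \<delta>)"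
    if P: "0 < n" "0 < m" "0 < k" "0 < \<epsilon>" "\<epsilon> < 1" "0 < \<delta>" "\<delta> < 1" for n m k \<epsilon> \<delta>
  proof (intro conjI ballI)
    note A' = A[OF P, THEN conjunct1]
    show "streaming_algorithm (cube n k) (\<Lambda> n m k \<epsilon> \<delta>)"
      unfolding \<Lambda>_def by (intro streaming_algorithm_parallel A')
    fix xs assume xs: "xs \<in> streams_of n m k"
    then have "set xs \<subseteq> cube n k" by (simp add: streams_of_def)
    from prob_median_of_means_ge[OF assms(1)[OF P(1-3)] A' A[OF P, THEN conjunct2] xs this P(4) s1[OF P(4)]]
    show "measure_pmf.prob (alg_output (\<Lambda> n m k \<epsilon> \<delta>) xs)
        {(1 - \<epsilon>) * sqnorm n k (v n m k xs) .. (1 + \<epsilon>) * sqnorm n k (v n m k xs)} \<ge> 1 - \<delta>"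
      unfolding \<Lambda>_def using s2[OF P(6,7)] by (meson diff_left_mono order_trans)
  qed
  have small: "param_bigo (\<lambda>(n, m, k, \<epsilon>, \<delta>). real (alg_bits (\<Lambda> n m k \<epsilon> \<delta>)))
      (\<lambda>(n, m, k, \<epsilon>, \<delta>). 3 ^ k * (1 / \<epsilon>\<^sup>2) * ln (1 / \<delta>) * \<mu> n m k \<epsilon> \<delta>)"
    unfolding param_bigo_iff
  proof (rule ballI)
    fix \<delta>\<^sub>0 :: real assume \<delta>\<^sub>0: "\<delta>\<^sub>0 \<in> {0<..<1}"
    with bits obtain c where c: "c > 0" "\<And>n m k \<epsilon> \<delta>. 0 < n \<Longrightarrow> 0 < m \<Longrightarrow> 0 < k \<Longrightarrow> 0 < \<epsilon> \<Longrightarrow> \<epsilon> < 1 \<Longrightarrow>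
        0 < \<delta> \<Longrightarrow> \<delta> \<le> \<delta>\<^sub>0 \<Longrightarrow> real (alg_bits (A n m k \<epsilon> \<delta>)) \<le> c * \<bar>\<mu> n m k \<epsilon> \<delta>\<bar>"
      unfolding param_bigo_iff by fastforce
    define K where "K = 1 / L + 1 / ln (1 / \<delta>\<^sub>0)"
    have K: "0 < K" using \<delta>\<^sub>0 L by (auto simp: K_def intro!: add_pos_pos)
    \<comment> \<open>The constant is the product of those for the number of means, the number of
      copies in each mean, and the memory of a single copy. It depends on no parameter except the
      bound \<open>\<delta>\<^sub>0\<close>.\<close>
    have "real (alg_bits (\<Lambda> n m k \<epsilon> \<delta>)) \<le> (K * 5 * c) * \<bar>3 ^ k * (1 / \<epsilon>\<^sup>2) * ln (1 / \<delta>) * \<mu> n m k \<epsilon> \<delta>\<bar>"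
      if P: "0 < n" "0 < m" "0 < k" "0 < \<epsilon>" "\<epsilon> < 1" "0 < \<delta>" "\<delta> \<le> \<delta>\<^sub>0" for n m k \<epsilon> \<delta>
    proof -
      have ln: "0 \<le> ln (1 / \<delta>)" using P \<delta>\<^sub>0 by simp
      have "real (alg_bits (\<Lambda> n m k \<epsilon> \<delta>)) = real (s2 \<delta>) * (real (s1 k \<epsilon>) * real (alg_bits (A n m k \<epsilon> \<delta>)))"
        by (simp add: \<Lambda>_def)
      also have "\<dots> \<le> (K * ln (1 / \<delta>)) * ((5 * (3 ^ k * (1 / \<epsilon>\<^sup>2))) * (c * \<bar>\<mu> n m k \<epsilon> \<delta>\<bar>))"
        using s2'[OF P(6,7)] s1'[OF P(4,5), of k] c(2)[OF P] c(1) K ln \<delta>\<^sub>0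
        by (intro mult_mono) (auto simp: K_def)
      also have "\<dots> = (K * 5 * c) * \<bar>3 ^ k * (1 / \<epsilon>\<^sup>2) * ln (1 / \<delta>) * \<mu> n m k \<epsilon> \<delta>\<bar>"
        using ln by (simp add: abs_mult)
      finally show ?thesis .
    qed
    then show "\<exists>c>0. \<forall>n m k \<epsilon> \<delta>. 0 < n \<and> 0 < m \<and> 0 < k \<and> 0 < \<epsilon> \<and> \<epsilon> < 1 \<and> 0 < \<delta> \<and> \<delta> \<le> \<delta>\<^sub>0 \<longrightarrow>
        \<bar>(case (n, m, k, \<epsilon>, \<delta>) of (n, m, k, \<epsilon>, \<delta>) \<Rightarrow> real (alg_bits (\<Lambda> n m k \<epsilon> \<delta>)))\<bar> \<le>
        c * \<bar>case (n, m, k, \<epsilon>, \<delta>) of (n, m, k, \<epsilon>, \<delta>) \<Rightarrow> 3 ^ k * (1 / \<epsilon>\<^sup>2) * ln (1 / \<delta>) * \<mu> n m k \<epsilon> \<delta>\<bar>"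
      using K c(1) by (intro exI[of _ "K * 5 * c"]) auto
  qed
  show ?thesis by (intro exI[of _ \<Lambda>] conjI[OF _ small] allI impI) (rule accurate)
qed

end
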